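(* Let $c$ satisfy (B0)–(B1), let $u=u^{c^*c}$ be a $c$-convex function (which implies $\partial^cu(\overline U)=\overline V$), and let $\lambda,\Lambda>0$. (a) If $|\partial^cu|\ge\lambda$ on $X\subset\overline U$ and $V$ is strongly $c^*$-convex with respect to $X$, then interior points of $X$ cannot be mapped by $\partial^cu$ to boundary points of $V$: i.e. $(X\times\partial V)\cap\partial^cu\subset\partial X\times\partial V$. (b) If $|\partial^cu|\le\Lambda$ on $\overline U$, and $U$ is strongly $c$-convex with respect to $V$, then boundary points of $U$ cannot be mapped by $\partial^cu$ into interior points of $V$: i.e. $\partial U\times V$ is disjoint from $\partial^cu$.
   Context: $D_x, D_y$ denote derivatives in the first and second variables of $c$. (B0) $U,V\subset\mathbb R^n$ are open and bounded and $c\in C^4(\overline U\times\overline V)$. (B1) For each $(\tilde x,\tilde y)\in\overline U\times\overline V$, the maps $x\in\overline U\mapsto -D_yc(x,\tilde y)$ and $y\in\overline V\mapsto -D_xc(\tilde x,y)$ are diffeomorphisms onto their ranges. $v^c(x):=\sup_{y\in\overline V}-c(x,y)-v(y)$, $u^{c^*}(y):=\sup_{x\in\overline U}-c(x,y)-u(x)$; $u$ is $c$-convex if $u=u^{c^*c}:=(u^{c^*})^c$. $\partial^cu:=\{(x,y)\in\overline U\times\overline V: u(x)+u^{c^*}(y)+c(x,y)=0\}$, $\partial^cu(x):=\{y:(x,y)\in\partial^cu\}$, $\partial^cu(X):=\bigcup_{x\in X}\partial^cu(x)$. The $c$-Monge–Ampère measure is $|\partial^cu|(X):=\mathscr L^n(\partial^cu(X))$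 for Borel $X$; "$|\partial^cu|\ge\lambda$ on $X$" means $|\partial^cu|(X')\ge\lambda\mathscr L^n(X')$ for all Borel $X'\subset X$, and similarly for "$\le\Lambda$". A convex set $Q\subset\mathbb R^n$ is strongly convex if there is $R<\infty$ such that for each $\tilde x\in\partial Q$ one has $Q\subset B_R(\tilde x-R\hat n_Q(\tilde x))$, where $\hat n_Q(\tilde x)$ is an outer unit normal to a hyperplane supporting $Q$ at $\tilde x$. $V$ is strongly $c^*$-convex with respect to $X$ if $-D_xc(\tilde x,V)$ is a strongly convex set for every $\tilde x\in X$; $U$ is strongly $c$-convex with respect to $V$ if $-D_yc(U,\tilde y)$ is a strongly convex set for every $\tilde y\in V$. *)

theory Defs
  imports "HOL-Analysis.Analysis"
begin

section \<open>Regularity\<close>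

text \<open>\<open>Ck_on k W f\<close>: \<open>f\<close> is of class \<open>C\<^sup>k\<close> on the open set \<open>W\<close>; all iterated directional
  derivatives up to order \<open>k\<close> exist and are continuous.\<close>

primrec Ck_on ::
  "nat \<Rightarrow> 'a::euclidean_space set \<Rightarrow> ('a \<Rightarrow> 'b::real_normed_vector) \<Rightarrow> bool" where
  "Ck_on 0 W f \<longleftrightarrow> continuous_on W f"
| "Ck_on (Suc k) W f \<longleftrightarrow> (\<forall>x\<in>W. f differentiable at x) \<and>
     (\<forall>v. Ck_on k W (\<lambda>x. frechet_derivative f (at x) v))"

text \<open>A function is \<open>C\<^sup>k\<close> on a closed set if it is the restriction of a \<open>C\<^sup>k\<close> function on an open
  neighbourhood. Functions being total here, \<open>f\<close> itself plays the role of the extension. On the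
  closure of an open set, the derivatives do not depend on the extension.\<close>

definition Ck_near ::
  "nat \<Rightarrow> 'a::euclidean_space set \<Rightarrow> ('a \<Rightarrow> 'b::real_normed_vector) \<Rightarrow> bool" where
  "Ck_near k A f \<longleftrightarrow> (\<exists>W. open W \<and> A \<subseteq> W \<and> Ck_on k W f)"

definition diffeo_onto_range ::
  "'a::euclidean_space set \<Rightarrow> ('a \<Rightarrow> 'b::euclidean_space) \<Rightarrow> bool" where
  "diffeo_onto_range A f \<longleftrightarrow>
     Ck_near 1 A f \<and> (\<exists>g. Ck_near 1 (f ` A) g \<and> (\<forall>x\<in>A. g (f x) = x))"

section \<open>The cost function\<close>

text \<open>The partial derivatives of \<open>c\<close> are represented by gradient vectors.\<close>

definition Dx :: "('a::euclidean_space \<Rightarrow> 'b \<Rightarrow> real) \<Rightarrow> 'a \<Rightarrow> 'b \<Rightarrow> 'a" where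
  "Dx c x y = (THE d. GDERIV (\<lambda>x'. c x' y) x :> d)"

definition Dy :: "('a \<Rightarrow> 'b::euclidean_space \<Rightarrow> real) \<Rightarrow> 'a \<Rightarrow> 'b \<Rightarrow> 'b" where
  "Dy c x y = (THE d. GDERIV (\<lambda>y'. c x y') y :> d)"

definition B0 ::
  "'a::euclidean_space set \<Rightarrow> 'a set \<Rightarrow> ('a \<Rightarrow> 'a \<Rightarrow> real) \<Rightarrow> bool" where
  "B0 U V c \<longleftrightarrow> open U \<and> bounded U \<and> open V \<and> bounded V \<and>
     Ck_near 4 (closure U \<times> closure V) (\<lambda>(x, y). c x y)"

definition B1 ::
  "'a::euclidean_space set \<Rightarrow> 'a set \<Rightarrow> ('a \<Rightarrow> 'a \<Rightarrow> real) \<Rightarrow> bool" where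
  "B1 U V c \<longleftrightarrow> (\<forall>x0\<in>closure U. \<forall>y0\<in>closure V.
     diffeo_onto_range (closure U) (\<lambda>x. - Dy c x y0) \<and>
     diffeo_onto_range (closure V) (\<lambda>y. - Dx c x0 y))"

section \<open>c-convex functions\<close>

definition c_transform :: "'b::topological_space set \<Rightarrow> ('a \<Rightarrow> 'b \<Rightarrow> real) \<Rightarrow> ('b \<Rightarrow> ereal) \<Rightarrow> 'a \<Rightarrow> ereal"
  where "c_transform V c v x = (SUP y\<in>closure V. - ereal (c x y) - v y)"

definition cstar_transform :: "'a::topological_space set \<Rightarrow> ('a \<Rightarrow> 'b \<Rightarrow> real) \<Rightarrow> ('a \<Rightarrow> ereal) \<Rightarrow> 'b \<Rightarrow> ereal"
  where "cstar_transform U c u y = (SUP x\<in>closure U. - ereal (c x y) - u x)"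

text \<open>Potentials are real-valued: this excludes only the functions identically \<open>\<infinity>\<close> or \<open>-\<infinity>\<close>,
  since under (B0) every other extended-real function with \<open>u = u\<^sup>c\<^sup>*\<^sup>c\<close> is finite. The transforms
  are taken in the extended reals, so that suprema are genuine.\<close>

definition c_convex ::
  "'a::topological_space set \<Rightarrow> 'a set \<Rightarrow> ('a \<Rightarrow> 'a \<Rightarrow> real) \<Rightarrow> ('a \<Rightarrow> real) \<Rightarrow> bool" where
  "c_convex U V c u \<longleftrightarrow>
     (\<forall>x\<in>closure U. ereal (u x) = c_transform V c (cstar_transform U c (\<lambda>x. ereal (u x))) x)"

text \<open>\<open>\<partial>\<^sup>cu\<close> as a relation; the set \<open>\<partial>\<^sup>cu(X)\<close> is the relational image \<open>c_subdiff U V c u `` X\<close>.\<close>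

definition c_subdiff ::
  "'a::topological_space set \<Rightarrow> 'a set \<Rightarrow> ('a \<Rightarrow> 'a \<Rightarrow> real) \<Rightarrow> ('a \<Rightarrow> real) \<Rightarrow> ('a \<times> 'a) set" where
  "c_subdiff U V c u = {(x, y) \<in> closure U \<times> closure V.
     ereal (u x) + cstar_transform U c (\<lambda>x. ereal (u x)) y + ereal (c x y) = 0}"

text \<open>Lebesgue rather than Borel measure, as \<open>\<partial>\<^sup>cu(X)\<close> need not be Borel for Borel \<open>X\<close>.\<close>

definition c_MA ::
  "'a::euclidean_space set \<Rightarrow> 'a set \<Rightarrow> ('a \<Rightarrow> 'a \<Rightarrow> real) \<Rightarrow> ('a \<Rightarrow> real) \<Rightarrow> 'a set \<Rightarrow> ennreal" where
  "c_MA U V c u X = emeasure lebesgue (c_subdiff U V c u `` X)"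

definition c_MA_ge_on ::
  "'a::euclidean_space set \<Rightarrow> 'a set \<Rightarrow> ('a \<Rightarrow> 'a \<Rightarrow> real) \<Rightarrow> ('a \<Rightarrow> real) \<Rightarrow> real \<Rightarrow> 'a set \<Rightarrow> bool" where
  "c_MA_ge_on U V c u l X \<longleftrightarrow>
     (\<forall>X'\<in>sets borel. X' \<subseteq> X \<longrightarrow> c_MA U V c u X' \<ge> ennreal l * emeasure lebesgue X')"

definition c_MA_le_on ::
  "'a::euclidean_space set \<Rightarrow> 'a set \<Rightarrow> ('a \<Rightarrow> 'a \<Rightarrow> real) \<Rightarrow> ('a \<Rightarrow> real) \<Rightarrow> real \<Rightarrow> 'a set \<Rightarrow> bool" where
  "c_MA_le_on U V c u L X \<longleftrightarrow>
     (\<forall>X'\<in>sets borel. X' \<subseteq> X \<longrightarrow> c_MA U V c u X' \<le> ennreal L * emeasure lebesgue X')"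

section \<open>Strong convexity\<close>

text \<open>The vector \<open>N\<close> is the outer unit normal of a hyperplane supporting \<open>Q\<close> at \<open>x\<close>. The closed ball
  allows \<open>Q\<close> to contain the touching point; for open \<open>Q\<close>, open and closed ball are equivalent.\<close>

definition strongly_convex :: "'a::euclidean_space set \<Rightarrow> bool" where
  "strongly_convex Q \<longleftrightarrow> convex Q \<and>
     (\<exists>R>0. \<forall>x\<in>frontier Q. \<exists>N. norm N = 1 \<and> (\<forall>z\<in>Q. N \<bullet> (z - x) \<le> 0) \<and>
        Q \<subseteq> cball (x - R *\<^sub>R N) R)"

definition strongly_cstar_convex_wrt ::
  "('a::euclidean_space \<Rightarrow> 'a \<Rightarrow> real) \<Rightarrow> 'a set \<Rightarrow> 'a set \<Rightarrow> bool" where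
  "strongly_cstar_convex_wrt c V X \<longleftrightarrow> (\<forall>x\<in>X. strongly_convex ((\<lambda>y. - Dx c x y) ` V))"

definition strongly_c_convex_wrt ::
  "('a::euclidean_space \<Rightarrow> 'a \<Rightarrow> real) \<Rightarrow> 'a set \<Rightarrow> 'a set \<Rightarrow> bool" where
  "strongly_c_convex_wrt c U V \<longleftrightarrow> (\<forall>y\<in>V. strongly_convex ((\<lambda>x. - Dy c x y) ` U))"

end

theory Submission
  imports Defs
begin

text \<open>
  A pair of points of \<open>\<partial>\<^sup>cu\<close> satisfies \<open>f(x,y) := c(x,y) - c(x,y\<^sub>0) - c(x\<^sub>0,y) + c(x\<^sub>0,y\<^sub>0) \<le> 0\<close>
  relative to a fixed \<open>(x\<^sub>0,y\<^sub>0) \<in> \<partial>\<^sup>cu\<close>. Let \<open>x\<^sub>0\<close> be interior and \<open>y\<^sub>0 \<in> \<partial>V\<close>, put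
  \<open>w(y) = -D\<^sub>xc(x\<^sub>0,y) + D\<^sub>xc(x\<^sub>0,y\<^sub>0)\<close>, and let \<open>N\<close> be the outer normal at \<open>w = 0\<close>; strong convexity
  says \<open>|w|\<^sup>2 \<le> -2R w\<bullet>N\<close>. For small \<open>r > 0\<close> choose \<open>x\<^sub>r = x\<^sub>0 + rN + o(r)\<close> such that
  \<open>D\<^sub>yc(\<cdot>,y\<^sub>0)\<close> is exactly affine in \<open>r\<close> along the curve. Then the terms linear in \<open>y - y\<^sub>0\<close> cancel in
  \<open>f(x\<^sub>r,y) + r w(y)\<bullet>N\<close>, and four derivatives of \<open>c\<close> bound it by \<open>o(r)|y - y\<^sub>0|\<^sup>2\<close>, which strong
  convexity absorbs. With \<open>r\<close> fixed, this forces the image of the ball of radius \<open>\<epsilon>\<close> about \<open>x\<^sub>r\<close> into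
  a slab \<open>{|y - y\<^sub>0| \<le> C\<epsilon>, |a\<bullet>(y - y\<^sub>0)| \<le> o(\<epsilon>)}\<close> with \<open>a \<noteq> 0\<close>, of volume \<open>o(\<epsilon>\<^sup>n)\<close>, which
  contradicts the lower bound in (a). Part (b) is the same estimate with the variables exchanged,
  applied to the preimage under \<open>\<partial>\<^sup>cu\<close> of a ball in \<open>V\<close>.
\<close>

section \<open>Iterated directional derivatives\<close>

text \<open>The direction comes first so that \<open>fold dir_deriv vs F\<close> is the iterated
  derivative along the list \<open>vs\<close>, its head being applied first.\<close>

definition dir_deriv :: "'a::real_normed_vector \<Rightarrow> ('a \<Rightarrow> 'b::real_normed_vector) \<Rightarrow> 'a \<Rightarrow> 'b" where
  "dir_deriv v F = (\<lambda>z. frechet_derivative F (at z) v)"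

lemma Ck_on_Suc_iff:
  "Ck_on (Suc k) W F \<longleftrightarrow> (\<forall>z\<in>W. F differentiable at z) \<and> (\<forall>v. Ck_on k W (dir_deriv v F))"
  by (simp add: dir_deriv_def)

declare Ck_on.simps(2) [simp del]

lemma Ck_on_lower: "Ck_on (Suc k) W F \<Longrightarrow> Ck_on k W F"
proof (induction k arbitrary: F)
  case 0
  then show ?case
    by (auto simp: Ck_on_Suc_iff intro!: continuous_at_imp_continuous_on differentiable_imp_continuous_within)
next
  case (Suc k)
  then show ?case
    by (metis Ck_on_Suc_iff)
qed

lemma Ck_on_mono: "Ck_on k W F \<Longrightarrow> j \<le> k \<Longrightarrow> Ck_on j W F"
  by (induction k) (auto simp: le_Suc_eq dest: Ck_on_lower)

lemma Ck_on_dir_deriv: "Ck_on (Suc k) W F \<Longrightarrow> Ck_on k W (dir_deriv v F)"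
  by (simp add: Ck_on_Suc_iff)

lemma has_derivative_dir_deriv:
  assumes "Ck_on (Suc k) W F" "z \<in> W"
  shows "(F has_derivative (\<lambda>v. dir_deriv v F z)) (at z)"
  using assms unfolding Ck_on_Suc_iff dir_deriv_def by (metis frechet_derivative_works)

lemma dir_deriv_unique:
  "(F has_derivative F') (at z) \<Longrightarrow> dir_deriv v F z = F' v"
  unfolding dir_deriv_def by (metis frechet_derivative_at)

lemma dir_deriv_cong:
  assumes "open W" "\<And>z. z \<in> W \<Longrightarrow> F z = G z" "z \<in> W"
  shows "dir_deriv v F z = dir_deriv v G z"
proof -
  have "(F has_derivative F') (at z) \<longleftrightarrow> (G has_derivative F') (at z)" for F'
    using has_derivative_transform_within_open[OF _ assms(1) assms(3), of F F' UNIV G]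
      has_derivative_transform_within_open[OF _ assms(1) assms(3), of G F' UNIV F] assms(2) by auto
  then show ?thesis
    by (simp add: dir_deriv_def frechet_derivative_def)
qed

text \<open>\<open>Ck_on\<close> speaks about total functions, whereas formulas for a derivative are
  only known on \<open>W\<close>. On an open set the values determine the derivatives, so they may
  be rewritten there.\<close>

lemma Ck_on_cong:
  assumes "open W"
  shows "(\<And>z. z \<in> W \<Longrightarrow> F z = G z) \<Longrightarrow> Ck_on k W F \<Longrightarrow> Ck_on k W G"
proof (induction k arbitrary: F G)
  case 0
  then show ?case
    by (metis Ck_on.simps(1) continuous_on_cong)
next
  case (Suc k)
  have "G differentiable at z" if "z \<in> W" for z
    using Suc.prems(2) has_derivative_transform_within_open[OF _ assms that Suc.prems(1)] that
    unfolding Ck_on_Suc_iff differentiable_def by fast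
  moreover have "Ck_on k W (dir_deriv v G)" for v
    using Suc.prems(2) dir_deriv_cong[OF assms, of F G] Suc.prems(1)
    by (intro Suc.IH[of "dir_deriv v F" "dir_deriv v G"]) (auto simp: Ck_on_Suc_iff)
  ultimately show ?case
    by (simp add: Ck_on_Suc_iff)
qed

text \<open>Its use is the coordinate swap of a product, through which the cost with exchanged
  variables inherits its regularity. The derivative of the composite along \<open>v\<close> is the
  derivative of \<open>F\<close> along \<open>T v\<close>, composed with \<open>T\<close>, so the
  induction applies again.\<close>

lemma Ck_on_linear_comp:
  fixes T :: "'a::euclidean_space \<Rightarrow> 'a"
  assumes "open W" and T: "bounded_linear T"
  shows "Ck_on k W F \<Longrightarrow> Ck_on k (T -` W) (\<lambda>z. F (T z))"
proof (induction k arbitrary: F)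
  case 0
  then show ?case
    using continuous_on_compose2[of W F "T -` W" T] linear_continuous_on[OF T] by auto
next
  case (Suc k)
  have der: "((\<lambda>z. F (T z)) has_derivative (\<lambda>v. dir_deriv (T v) F (T z))) (at z)" if "T z \<in> W" for z
    by (rule has_derivative_compose[OF bounded_linear_imp_has_derivative[OF T]
          has_derivative_dir_deriv[OF Suc.prems that]])
  have "continuous_on UNIV T"
    by (rule linear_continuous_on[OF T])
  then have "open (T -` W)"
    using \<open>open W\<close> by (simp add: continuous_open_vimage continuous_on_eq_continuous_at)
  have "Ck_on k (T -` W) (dir_deriv v (\<lambda>z. F (T z)))" for v
  proof (rule Ck_on_cong[OF \<open>open (T -` W)\<close>, of "\<lambda>z. dir_deriv (T v) F (T z)"])
    show "Ck_on k (T -` W) (\<lambda>z. dir_deriv (T v) F (T z))"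
      by (rule Suc.IH[OF Ck_on_dir_deriv[OF Suc.prems]])
    show "dir_deriv (T v) F (T z) = dir_deriv v (\<lambda>z. F (T z)) z" if "z \<in> T -` W" for z
      using dir_deriv_unique[OF der, of z v] that by simp
  qed
  then show ?case
    using der by (auto simp: Ck_on_Suc_iff differentiable_def)
qed

lemma dir_deriv_basis:
  fixes F :: "'a::euclidean_space \<Rightarrow> 'b::real_normed_vector"
  assumes "Ck_on (Suc k) W F" "z \<in> W"
  shows "dir_deriv v F z = (\<Sum>b\<in>Basis. (v \<bullet> b) *\<^sub>R dir_deriv b F z)"
proof -
  have lin: "linear (\<lambda>v. dir_deriv v F z)"
    using has_derivative_linear[OF has_derivative_dir_deriv[OF assms]] .
  have "dir_deriv v F z = dir_deriv (\<Sum>b\<in>Basis. (v \<bullet> b) *\<^sub>R b) F z"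
    by (simp add: euclidean_representation)
  also have "\<dots> = (\<Sum>b\<in>Basis. (v \<bullet> b) *\<^sub>R dir_deriv b F z)"
    unfolding linear_sum[OF lin] linear_scale[OF lin] ..
  finally show ?thesis .
qed

lemma fold_dir_deriv_cong:
  assumes "open W"
  shows "(\<And>z. z \<in> W \<Longrightarrow> F z = G z) \<Longrightarrow> z \<in> W \<Longrightarrow>
    fold dir_deriv vs F z = fold dir_deriv vs G z"
proof (induction vs arbitrary: F G)
  case (Cons v vs)
  show ?case
    unfolding fold_simps
    by (rule Cons.IH[OF dir_deriv_cong[OF assms Cons.prems(1)] Cons.prems(2)])
qed auto

text \<open>Coefficients of an expansion in a basis do not depend on \<open>z\<close>, so they pass
  through all later derivatives.\<close>

lemma fold_dir_deriv_sum:
  assumes "open W" "finite I"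
  shows "(\<And>i. i \<in> I \<Longrightarrow> Ck_on (length vs) W (G i)) \<Longrightarrow> z \<in> W \<Longrightarrow>
    fold dir_deriv vs (\<lambda>z. \<Sum>i\<in>I. a i *\<^sub>R G i z) z = (\<Sum>i\<in>I. a i *\<^sub>R fold dir_deriv vs (G i) z)"
proof (induction vs arbitrary: G)
  case (Cons v vs)
  have der: "((\<lambda>z. \<Sum>i\<in>I. a i *\<^sub>R G i z) has_derivative (\<lambda>v. \<Sum>i\<in>I. a i *\<^sub>R dir_deriv v (G i) z)) (at z)"
    if "z \<in> W" for z
    using has_derivative_dir_deriv[of "length vs" W "G _", OF _ that] Cons.prems(1)
    by (intro has_derivative_sum has_derivative_scaleR_right) simp
  have deq: "dir_deriv v (\<lambda>z. \<Sum>i\<in>I. a i *\<^sub>R G i z) z = (\<Sum>i\<in>I. a i *\<^sub>R dir_deriv v (G i) z)"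
    if "z \<in> W" for z
    by (rule dir_deriv_unique) (rule der[OF that])
  have "fold dir_deriv (v # vs) (\<lambda>z. \<Sum>i\<in>I. a i *\<^sub>R G i z) z
      = fold dir_deriv vs (\<lambda>z. \<Sum>i\<in>I. a i *\<^sub>R dir_deriv v (G i) z) z"
    unfolding fold_simps by (rule fold_dir_deriv_cong[OF assms(1) deq \<open>z \<in> W\<close>])
  also have "\<dots> = (\<Sum>i\<in>I. a i *\<^sub>R fold dir_deriv vs (dir_deriv v (G i)) z)"
    using Cons.prems by (intro Cons.IH) (auto simp: Ck_on_Suc_iff)
  finally show ?case by simp
qed auto

text \<open>For one fixed tuple of directions, continuity on the compact set gives a bound.
  Uniformity in the directions comes from expanding the first one in the basis and applying the
  induction hypothesis to the finitely many derivatives \<open>dir_deriv b F\<close>.\<close>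

lemma Ck_on_compact_bound:
  fixes F :: "'a::euclidean_space \<Rightarrow> 'b::real_normed_vector"
  assumes "open W" "compact K" "K \<subseteq> W"
  shows "Ck_on m W F \<Longrightarrow> \<exists>M\<ge>0. \<forall>z\<in>K. \<forall>vs. length vs = m \<longrightarrow>
    norm (fold dir_deriv vs F z) \<le> M * (\<Prod>v\<leftarrow>vs. norm v)"
proof (induction m arbitrary: F)
  case 0
  then have "bounded (F ` K)"
    using assms by (auto intro!: compact_imp_bounded compact_continuous_image intro: continuous_on_subset)
  then obtain M where M: "\<forall>z\<in>K. norm (F z) \<le> M"
    by (auto simp: bounded_iff)
  \<comment> \<open>The maximum with 0 is for an empty \<open>K\<close>, where \<open>M\<close> may
    be negative.\<close>
  show ?case
    by (rule exI[of _ "max M 0"]) (use M in \<open>auto intro: le_max_iff_disj[THEN iffD2]\<close>)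
next
  case (Suc m)
  have "\<forall>b. \<exists>M\<ge>0. \<forall>z\<in>K. \<forall>vs. length vs = m \<longrightarrow>
      norm (fold dir_deriv vs (dir_deriv b F) z) \<le> M * (\<Prod>v\<leftarrow>vs. norm v)"
    using Suc by (simp add: Ck_on_Suc_iff)
  then obtain M where M0: "\<And>b. M b \<ge> 0" and M: "\<And>b z vs. z \<in> K \<Longrightarrow> length vs = m \<Longrightarrow>
      norm (fold dir_deriv vs (dir_deriv b F) z) \<le> M b * (\<Prod>v\<leftarrow>vs. norm v)"
    by metis
  show ?case
  proof (intro exI[of _ "\<Sum>b\<in>Basis. M b"] conjI ballI allI impI)
    show "0 \<le> (\<Sum>b\<in>Basis. M b)"
      by (simp add: M0 sum_nonneg)
    fix z and ws :: "'a list" assume z: "z \<in> K" and "length ws = Suc m"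
    then obtain v vs where ws: "ws = v # vs" and len: "length vs = m"
      by (metis length_Suc_conv)
    have P0: "0 \<le> (\<Prod>v\<leftarrow>vs. norm v)"
      by (induction vs) auto
    have zW: "z \<in> W"
      using z assms by auto
    have "fold dir_deriv ws F z = fold dir_deriv vs (\<lambda>z. \<Sum>b\<in>Basis. (v \<bullet> b) *\<^sub>R dir_deriv b F z) z"
      unfolding ws fold_simps by (rule fold_dir_deriv_cong[OF assms(1) _ zW]) (rule dir_deriv_basis[OF Suc.prems])
    also have "\<dots> = (\<Sum>b\<in>Basis. (v \<bullet> b) *\<^sub>R fold dir_deriv vs (dir_deriv b F) z)"
      using Suc.prems len by (intro fold_dir_deriv_sum[OF assms(1) _ _ zW]) (auto simp: Ck_on_Suc_iff)
    finally have "norm (fold dir_deriv ws F z) = norm (\<Sum>b\<in>Basis. (v \<bullet> b) *\<^sub>R fold dir_deriv vs (dir_deriv b F) z)"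
      by simp
    also have "\<dots> \<le> (\<Sum>b\<in>Basis. norm v * (M b * (\<Prod>v\<leftarrow>vs. norm v)))"
      using M[OF z len] Basis_le_norm[of _ v]
      by (intro sum_norm_le) (auto intro!: mult_mono)
    finally show "norm (fold dir_deriv ws F z) \<le> (\<Sum>b\<in>Basis. M b) * (\<Prod>v\<leftarrow>ws. norm v)"
      by (simp add: ws sum_distrib_left sum_distrib_right mult_ac)
  qed
qed

section \<open>Taylor bounds along segments\<close>

lemma has_real_derivative_along:
  fixes F :: "'a::euclidean_space \<Rightarrow> real"
  assumes "Ck_on (Suc k) W F" "z + t *\<^sub>R v \<in> W"
  shows "((\<lambda>s. F (z + s *\<^sub>R v)) has_real_derivative dir_deriv v F (z + t *\<^sub>R v)) (at t)"
proof -
  have der: "(F has_derivative (\<lambda>w. dir_deriv w F (z + t *\<^sub>R v))) (at (z + t *\<^sub>R v))"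
    by (rule has_derivative_dir_deriv[OF assms])
  have "((\<lambda>s. F (z + s *\<^sub>R v)) has_derivative (\<lambda>s. dir_deriv (s *\<^sub>R v) F (z + t *\<^sub>R v))) (at t)"
    by (rule has_derivative_compose[of "\<lambda>s. z + s *\<^sub>R v" "\<lambda>s. s *\<^sub>R v" t UNIV F, OF _ der])
      (auto intro!: derivative_eq_intros)
  then show ?thesis
    using linear_scale[OF has_derivative_linear[OF der]]
    by (simp add: has_field_derivative_def mult_commute_abs)
qed

text \<open>Two applications of the mean value theorem give \<open>s * f'' r\<close> with
  \<open>0 < r < s < 1\<close>. The factor 1/2 of Taylor's formula is given away, since only the
  order matters.\<close>

lemma second_order_bound:
  fixes f f' f'' :: "real \<Rightarrow> real"
  assumes "\<And>t. 0 \<le> t \<Longrightarrow> t \<le> 1 \<Longrightarrow> (f has_real_derivative f' t) (at t)"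
    and "\<And>t. 0 \<le> t \<Longrightarrow> t \<le> 1 \<Longrightarrow> (f' has_real_derivative f'' t) (at t)"
    and bound: "\<And>t. 0 \<le> t \<Longrightarrow> t \<le> 1 \<Longrightarrow> \<bar>f'' t\<bar> \<le> B"
  shows "\<bar>f 1 - f 0 - f' 0\<bar> \<le> B"
proof -
  obtain s where s: "0 < s" "s < 1" "f 1 - f 0 = f' s"
    using MVT2[of 0 1 f f'] assms(1) by auto
  obtain r where r: "0 < r" "r < s" "f' s - f' 0 = s * f'' r"
    using MVT2[of 0 s f' f''] assms(2) s by auto
  have "\<bar>s * f'' r\<bar> \<le> 1 * B"
    unfolding abs_mult using s r bound[of r] by (intro mult_mono) auto
  then show ?thesis
    using s r by simp
qed

lemma taylor_remainder_bound:
  fixes F :: "'a::euclidean_space \<Rightarrow> real"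
  assumes F: "Ck_on 2 W F" and seg: "\<And>t. 0 \<le> t \<Longrightarrow> t \<le> 1 \<Longrightarrow> z + t *\<^sub>R v \<in> W"
    and "\<And>t. 0 \<le> t \<Longrightarrow> t \<le> 1 \<Longrightarrow> \<bar>dir_deriv v (dir_deriv v F) (z + t *\<^sub>R v)\<bar> \<le> B"
  shows "\<bar>F (z + v) - F z - dir_deriv v F z\<bar> \<le> B"
proof -
  have "Ck_on (Suc 1) W F" "Ck_on (Suc 0) W (dir_deriv v F)"
    using F by (auto simp: numeral_2_eq_2 Ck_on_dir_deriv)
  then show ?thesis
    using second_order_bound[of "\<lambda>t. F (z + t *\<^sub>R v)" "\<lambda>t. dir_deriv v F (z + t *\<^sub>R v)"
        "\<lambda>t. dir_deriv v (dir_deriv v F) (z + t *\<^sub>R v)" B] assms(2,3)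
    by (auto intro: has_real_derivative_along)
qed

section \<open>Mixed second differences and symmetry of second derivatives\<close>

lemma mixed_difference_MVT:
  fixes F :: "'a::euclidean_space \<Rightarrow> real"
  assumes F: "Ck_on 2 W F"
    and par: "\<And>s t. 0 \<le> s \<Longrightarrow> s \<le> 1 \<Longrightarrow> 0 \<le> t \<Longrightarrow> t \<le> 1 \<Longrightarrow> z + s *\<^sub>R v + t *\<^sub>R w \<in> W"
  obtains s t where "0 < s" "s < 1" "0 < t" "t < 1"
    "F (z + v + w) - F (z + v) - F (z + w) + F z = dir_deriv w (dir_deriv v F) (z + s *\<^sub>R v + t *\<^sub>R w)"
proof -
  have F1: "Ck_on (Suc 1) W F" and F2: "Ck_on (Suc 0) W (dir_deriv v F)"
    using F by (auto simp: numeral_2_eq_2 Ck_on_dir_deriv)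
  \<comment> \<open>The mean value theorem is applied along \<open>v\<close> to the increment along
    \<open>w\<close>, then once more along \<open>w\<close>.\<close>
  let ?f = "\<lambda>s. F (z + w + s *\<^sub>R v) - F (z + s *\<^sub>R v)"
  let ?f' = "\<lambda>s. dir_deriv v F (z + w + s *\<^sub>R v) - dir_deriv v F (z + s *\<^sub>R v)"
  have "(?f has_real_derivative ?f' s) (at s)" if "0 \<le> s" "s \<le> 1" for s
    using par[OF that, of 0] par[OF that, of 1]
    by (intro DERIV_diff has_real_derivative_along[OF F1]) (auto simp: algebra_simps)
  then obtain s where s: "0 < s" "s < 1" "?f 1 - ?f 0 = ?f' s"
    using MVT2[of 0 1 ?f ?f'] by auto
  let ?g = "\<lambda>t. dir_deriv v F (z + s *\<^sub>R v + t *\<^sub>R w)"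
  let ?g' = "\<lambda>t. dir_deriv w (dir_deriv v F) (z + s *\<^sub>R v + t *\<^sub>R w)"
  have "(?g has_real_derivative ?g' t) (at t)" if "0 \<le> t" "t \<le> 1" for t
    using par[of s t] that s
    by (intro has_real_derivative_along[OF F2]) (auto simp: algebra_simps)
  then obtain t where t: "0 < t" "t < 1" "?g 1 - ?g 0 = ?g' t"
    using MVT2[of 0 1 ?g ?g'] by auto
  show ?thesis
    using that[OF s(1,2) t(1,2)] s(3) t(3) by (simp add: algebra_simps)
qed

lemma dir_deriv_scale:
  assumes "Ck_on (Suc k) W F" "z \<in> W"
  shows "dir_deriv (c *\<^sub>R v) F z = c *\<^sub>R dir_deriv v F z"
  using linear_scale[OF has_derivative_linear[OF has_derivative_dir_deriv[OF assms]]] by simp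

text \<open>Homogeneity in both directions extracts \<open>e\<^sup>2\<close>, so that second
  differences can be compared with second derivatives along the fixed directions \<open>v\<close>
  and \<open>w\<close>.\<close>

lemma mixed_difference_MVT_scaled:
  fixes F :: "'a::euclidean_space \<Rightarrow> real"
  assumes F: "Ck_on 2 W F" and "open W"
    and par: "\<And>s t. 0 \<le> s \<Longrightarrow> s \<le> e \<Longrightarrow> 0 \<le> t \<Longrightarrow> t \<le> e \<Longrightarrow> z + s *\<^sub>R v + t *\<^sub>R w \<in> W"
    and "e > 0"
  obtains s t where "0 < s" "s < e" "0 < t" "t < e"
    "F (z + e *\<^sub>R v + e *\<^sub>R w) - F (z + e *\<^sub>R v) - F (z + e *\<^sub>R w) + F z
      = e\<^sup>2 * dir_deriv w (dir_deriv v F) (z + s *\<^sub>R v + t *\<^sub>R w)"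
proof -
  have F1: "Ck_on (Suc 1) W F" and F2: "Ck_on (Suc 0) W (dir_deriv v F)"
    using F by (auto simp: numeral_2_eq_2 Ck_on_dir_deriv)
  have "z + s *\<^sub>R (e *\<^sub>R v) + t *\<^sub>R (e *\<^sub>R w) \<in> W" if "0 \<le> s" "s \<le> 1" "0 \<le> t" "t \<le> 1" for s t
    using par[of "s * e" "t * e"] that \<open>e > 0\<close> by (simp add: mult_left_le_one_le)
  from mixed_difference_MVT[OF F, of z "e *\<^sub>R v" "e *\<^sub>R w", OF this]
  obtain s t where st: "0 < s" "s < 1" "0 < t" "t < 1"
    "F (z + e *\<^sub>R v + e *\<^sub>R w) - F (z + e *\<^sub>R v) - F (z + e *\<^sub>R w) + F z
      = dir_deriv (e *\<^sub>R w) (dir_deriv (e *\<^sub>R v) F) (z + (s * e) *\<^sub>R v + (t * e) *\<^sub>R w)"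
    by auto
  let ?z = "z + (s * e) *\<^sub>R v + (t * e) *\<^sub>R w"
  have zW: "?z \<in> W"
    using st \<open>e > 0\<close> by (intro par) (auto simp: mult_le_cancel_right1 intro!: mult_left_le_one_le)
  have "dir_deriv (e *\<^sub>R v) F x = e *\<^sub>R dir_deriv v F x" if "x \<in> W" for x
    by (rule dir_deriv_scale[OF F1 that])
  then have "dir_deriv (e *\<^sub>R w) (dir_deriv (e *\<^sub>R v) F) ?z = dir_deriv (e *\<^sub>R w) (\<lambda>x. e *\<^sub>R dir_deriv v F x) ?z"
    using dir_deriv_cong[OF \<open>open W\<close> _ zW] by metis
  also have "\<dots> = e *\<^sub>R dir_deriv (e *\<^sub>R w) (dir_deriv v F) ?z"
    by (rule dir_deriv_unique) (rule has_derivative_scaleR_right[OF has_derivative_dir_deriv[OF F2 zW]])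
  also have "\<dots> = e\<^sup>2 * dir_deriv w (dir_deriv v F) ?z"
    using dir_deriv_scale[OF F2 zW] by (simp add: power2_eq_square)
  finally show ?thesis
    using that[of "s * e" "t * e"] st \<open>e > 0\<close> by simp
qed

text \<open>The second difference over a parallelogram is symmetric in \<open>v\<close> and
  \<open>w\<close>, and by the mean value theorem it equals \<open>e\<^sup>2\<close> times either
  iterated derivative at some nearby point. Continuity at \<open>z\<close> then rules out a gap
  between the two.\<close>

lemma dir_deriv_commute:
  fixes F :: "'a::euclidean_space \<Rightarrow> real"
  assumes F: "Ck_on 2 W F" and "open W" "z \<in> W"
  shows "dir_deriv v (dir_deriv w F) z = dir_deriv w (dir_deriv v F) z"
proof (rule ccontr)
  assume neq: "\<not> ?thesis"
  \<comment> \<open>Half the gap, so that no common value lies within \<open>d\<close> of both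
    derivatives.\<close>
  define d where "d = \<bar>dir_deriv v (dir_deriv w F) z - dir_deriv w (dir_deriv v F) z\<bar> / 2"
  have "d > 0"
    using neq by (simp add: d_def)
  have cont: "continuous (at z) (dir_deriv a (dir_deriv b F))" for a b
    using F assms by (auto simp: numeral_2_eq_2 Ck_on_Suc_iff continuous_on_eq_continuous_at)
  obtain r1 where r1: "r1 > 0" "\<And>x. dist x z < r1 \<Longrightarrow>
      \<bar>dir_deriv v (dir_deriv w F) x - dir_deriv v (dir_deriv w F) z\<bar> < d"
    using cont[of v w] \<open>d > 0\<close> unfolding continuous_at_eps_delta by (auto simp: dist_real_def)
  obtain r2 where r2: "r2 > 0" "\<And>x. dist x z < r2 \<Longrightarrow>
      \<bar>dir_deriv w (dir_deriv v F) x - dir_deriv w (dir_deriv v F) z\<bar> < d"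
    using cont[of w v] \<open>d > 0\<close> unfolding continuous_at_eps_delta by (auto simp: dist_real_def)
  obtain r3 where r3: "r3 > 0" "ball z r3 \<subseteq> W"
    using assms open_contains_ball by blast
  define r where "r = Min {r1, r2, r3}"
  \<comment> \<open>This size keeps the whole parallelogram within \<open>r / 2\<close> of
    \<open>z\<close>; the added 1 covers vanishing directions.\<close>
  define e where "e = r / (norm v + norm w + 1) / 2"
  have "r > 0" "e > 0"
    using r1 r2 r3 by (auto simp: r_def e_def divide_simps add_nonneg_pos)
  have near: "dist (z + s *\<^sub>R v + t *\<^sub>R w) z < r" if "0 \<le> s" "s \<le> e" "0 \<le> t" "t \<le> e" for s t
  proof -
    have "dist (z + s *\<^sub>R v + t *\<^sub>R w) z \<le> s * norm v + t * norm w"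
      unfolding dist_norm using norm_triangle_ineq[of "s *\<^sub>R v" "t *\<^sub>R w"] that by (simp add: algebra_simps)
    also have "\<dots> \<le> e * norm v + e * norm w"
      using that by (intro add_mono mult_right_mono) auto
    also have "\<dots> \<le> e * (norm v + norm w + 1)"
      using \<open>e > 0\<close> by (simp add: algebra_simps)
    also have "\<dots> = r / 2"
      unfolding e_def using add_nonneg_pos[of "norm v + norm w" 1] by (simp add: divide_simps)
    finally show ?thesis
      using \<open>r > 0\<close> by linarith
  qed
  have r123: "r \<le> r1" "r \<le> r2" "r \<le> r3"
    by (auto simp: r_def)
  have inW: "z + s *\<^sub>R v + t *\<^sub>R w \<in> W" if "0 \<le> s" "s \<le> e" "0 \<le> t" "t \<le> e" for s t
    using near[OF that] r3 r123 by (auto simp: dist_commute subset_iff)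
  obtain s t where 1: "0 < s" "s < e" "0 < t" "t < e"
    "F (z + e *\<^sub>R v + e *\<^sub>R w) - F (z + e *\<^sub>R v) - F (z + e *\<^sub>R w) + F z
      = e\<^sup>2 * dir_deriv w (dir_deriv v F) (z + s *\<^sub>R v + t *\<^sub>R w)"
    using mixed_difference_MVT_scaled[OF F \<open>open W\<close> inW \<open>e > 0\<close>] by blast
  have inW': "z + s *\<^sub>R w + t *\<^sub>R v \<in> W" if "0 \<le> s" "s \<le> e" "0 \<le> t" "t \<le> e" for s t
    using inW[of t s] that by (simp add: add_ac)
  obtain s' t' where 2: "0 < s'" "s' < e" "0 < t'" "t' < e"
    "F (z + e *\<^sub>R w + e *\<^sub>R v) - F (z + e *\<^sub>R w) - F (z + e *\<^sub>R v) + F z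
      = e\<^sup>2 * dir_deriv v (dir_deriv w F) (z + s' *\<^sub>R w + t' *\<^sub>R v)"
    using mixed_difference_MVT_scaled[OF F \<open>open W\<close> inW' \<open>e > 0\<close>] by blast
  have "z + e *\<^sub>R w + e *\<^sub>R v = z + e *\<^sub>R v + e *\<^sub>R w"
    by (simp add: add_ac)
  then have "e\<^sup>2 * dir_deriv v (dir_deriv w F) (z + s' *\<^sub>R w + t' *\<^sub>R v) = e\<^sup>2 * dir_deriv w (dir_deriv v F) (z + s *\<^sub>R v + t *\<^sub>R w)"
    using 1(5) 2(5) by (simp only:)
  moreover have "z + s' *\<^sub>R w + t' *\<^sub>R v = z + t' *\<^sub>R v + s' *\<^sub>R w"
    by (simp add: add_ac)
  ultimately have eq: "dir_deriv v (dir_deriv w F) (z + t' *\<^sub>R v + s' *\<^sub>R w) = dir_deriv w (dir_deriv v F) (z + s *\<^sub>R v + t *\<^sub>R w)"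
    using \<open>e > 0\<close> by simp
  have "\<bar>dir_deriv w (dir_deriv v F) (z + s *\<^sub>R v + t *\<^sub>R w) - dir_deriv v (dir_deriv w F) z\<bar> < d"
    using r1(2)[of "z + t' *\<^sub>R v + s' *\<^sub>R w"] near[of t' s'] 2(1-4) r123 eq by simp
  moreover have "\<bar>dir_deriv w (dir_deriv v F) (z + s *\<^sub>R v + t *\<^sub>R w) - dir_deriv w (dir_deriv v F) z\<bar> < d"
    using r2(2)[of "z + s *\<^sub>R v + t *\<^sub>R w"] near[of s t] 1(1-4) r123 by simp
  ultimately show False
    unfolding d_def by (smt (verit) field_sum_of_halves)
qed

text \<open>Taylor's formula in \<open>x\<close> is applied to the Taylor remainder in
  \<open>y\<close>. The subtracted bracket is the \<open>x\<close>-derivative of that remainder, and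
  its second \<open>x\<close>-derivative is again a Taylor remainder in \<open>y\<close>, now of a
  second \<open>x\<close>-derivative of \<open>F\<close>. Hence the bound on four derivatives, two
  in each variable.\<close>

lemma mixed_taylor_remainder:
  fixes F :: "'a::euclidean_space \<times> 'b::euclidean_space \<Rightarrow> real"
  defines "rem \<equiv> \<lambda>x y k. F (x, y + k) - F (x, y) - dir_deriv (0, k) F (x, y)"
  assumes F: "Ck_on 4 W F" and "open W" "P \<times> Q \<subseteq> W" "convex P" "convex Q"
    and P: "x \<in> P" "x + h \<in> P" and Q: "y \<in> Q" "y + k \<in> Q"
    and bound: "\<And>z. z \<in> P \<times> Q \<Longrightarrow>
      \<bar>dir_deriv (0, k) (dir_deriv (0, k) (dir_deriv (h, 0) (dir_deriv (h, 0) F))) z\<bar> \<le> B"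
  shows "\<bar>rem (x + h) y k - rem x y k -
    (dir_deriv (h, 0) F (x, y + k) - dir_deriv (h, 0) F (x, y) - dir_deriv (h, 0) (dir_deriv (0, k) F) (x, y))\<bar> \<le> B"
proof -
  let ?H = "(h, 0) :: 'a \<times> 'b" and ?K = "(0, k) :: 'a \<times> 'b"
  have F3: "Ck_on 3 W (dir_deriv v F)" for v
    using F Ck_on_dir_deriv[of 3] by simp
  have F2: "Ck_on 2 W (dir_deriv w (dir_deriv v F))" for v w
    using F3 by (intro Ck_on_dir_deriv[of 2]) simp
  have seg: "(x + s *\<^sub>R h, y + t *\<^sub>R k) \<in> P \<times> Q" if "0 \<le> s" "s \<le> 1" "0 \<le> t" "t \<le> 1" for s t
  proof -
    have "(1 - s) *\<^sub>R x + s *\<^sub>R (x + h) \<in> P" "(1 - t) *\<^sub>R y + t *\<^sub>R (y + k) \<in> Q"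
      using P Q \<open>convex P\<close> \<open>convex Q\<close> that by (auto intro!: convexD)
    then show ?thesis
      by (simp add: algebra_simps)
  qed
  have along: "((\<lambda>s. E (x + s *\<^sub>R h, y')) has_real_derivative dir_deriv ?H E (x + s *\<^sub>R h, y')) (at s)"
    if "Ck_on (Suc j) W E" "(x + s *\<^sub>R h, y') \<in> W" for E j s y'
    using has_real_derivative_along[OF that(1), of "(x, y')" s ?H] that(2) by simp
  \<comment> \<open>\<open>E\<close> is a parameter because differentiating \<open>r E\<close> along
    \<open>h\<close> yields \<open>r\<close> of the derivative of \<open>E\<close>, once the mixed
    derivatives are exchanged.\<close>
  define r where "r = (\<lambda>(E :: 'a \<times> 'b \<Rightarrow> real) x. E (x, y + k) - E (x, y) - dir_deriv ?K E (x, y))"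
  have r_der: "((\<lambda>s. r E (x + s *\<^sub>R h)) has_real_derivative
        r (dir_deriv ?H E) (x + s *\<^sub>R h)) (at s)"
    if E: "Ck_on (Suc (Suc 0)) W E" and s: "0 \<le> s" "s \<le> 1" for E s
  proof -
    have W: "(x + s *\<^sub>R h, y + k) \<in> W" "(x + s *\<^sub>R h, y) \<in> W"
      using seg[of s 0] seg[of s 1] s \<open>P \<times> Q \<subseteq> W\<close> by auto
    have "dir_deriv ?K (dir_deriv ?H E) (x + s *\<^sub>R h, y) = dir_deriv ?H (dir_deriv ?K E) (x + s *\<^sub>R h, y)"
      using dir_deriv_commute[OF _ \<open>open W\<close> W(2), of E] E by (simp add: numeral_2_eq_2)
    then show ?thesis
      unfolding r_def
      using along[OF E W(1)] along[OF E W(2)] along[OF Ck_on_dir_deriv[OF E] W(2), of ?K]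
      by (auto intro!: DERIV_diff)
  qed
  have "\<bar>r F (x + 1 *\<^sub>R h) - r F (x + 0 *\<^sub>R h) - r (dir_deriv ?H F) (x + 0 *\<^sub>R h)\<bar> \<le> B"
  proof (rule second_order_bound)
    fix s :: real assume s: "0 \<le> s" "s \<le> 1"
    show "((\<lambda>s. r F (x + s *\<^sub>R h)) has_real_derivative r (dir_deriv ?H F) (x + s *\<^sub>R h)) (at s)"
      using F by (intro r_der s Ck_on_mono[OF F]) simp
    show "((\<lambda>s. r (dir_deriv ?H F) (x + s *\<^sub>R h)) has_real_derivative
        r (dir_deriv ?H (dir_deriv ?H F)) (x + s *\<^sub>R h)) (at s)"
      by (intro r_der s Ck_on_mono[OF F3]) simp
    show "\<bar>r (dir_deriv ?H (dir_deriv ?H F)) (x + s *\<^sub>R h)\<bar> \<le> B"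
      using taylor_remainder_bound[OF F2, of "(x + s *\<^sub>R h, y)" ?K ?H ?H B]
        bound[OF seg[OF s]] subsetD[OF \<open>P \<times> Q \<subseteq> W\<close> seg[OF s]]
      by (simp add: r_def)
  qed
  moreover have "dir_deriv ?K (dir_deriv ?H F) (x, y) = dir_deriv ?H (dir_deriv ?K F) (x, y)"
    using seg[of 0 0] \<open>P \<times> Q \<subseteq> W\<close> by (intro dir_deriv_commute[OF Ck_on_mono[OF F] \<open>open W\<close>]) auto
  ultimately show ?thesis
    by (simp add: r_def rem_def)
qed

lemma Ck_on_4_bounds:
  fixes F :: "'a::euclidean_space \<times> 'b::euclidean_space \<Rightarrow> real"
  assumes F: "Ck_on 4 W F" and "open W" "compact K" "K \<subseteq> W"
  obtains M where "M > 0"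
    "\<And>z a b. z \<in> K \<Longrightarrow> \<bar>dir_deriv b (dir_deriv a F) z\<bar> \<le> M * norm a * norm b"
    "\<And>z a b c. z \<in> K \<Longrightarrow> \<bar>dir_deriv c (dir_deriv b (dir_deriv a F)) z\<bar> \<le> M * norm a * norm b * norm c"
    "\<And>z a b c d. z \<in> K \<Longrightarrow>
      \<bar>dir_deriv d (dir_deriv c (dir_deriv b (dir_deriv a F))) z\<bar> \<le> M * norm a * norm b * norm c * norm d"
proof -
  have "\<exists>M\<ge>0. \<forall>z\<in>K. \<forall>vs. length vs = m \<longrightarrow> norm (fold dir_deriv vs F z) \<le> M * (\<Prod>v\<leftarrow>vs. norm v)"
    if "m \<le> 4" for m
    by (rule Ck_on_compact_bound[OF assms(2,3,4) Ck_on_mono[OF F that]])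
  then obtain M where M: "\<And>m. m \<le> 4 \<Longrightarrow> M m \<ge> 0"
    "\<And>m z vs. m \<le> 4 \<Longrightarrow> z \<in> K \<Longrightarrow> length vs = m \<Longrightarrow> norm (fold dir_deriv vs F z) \<le> M m * (\<Prod>v\<leftarrow>vs. norm v)"
    by metis
  \<comment> \<open>One constant serves all orders; the added 1 makes it positive for later
    divisions.\<close>
  define M' where "M' = M 2 + M 3 + M 4 + 1"
  have le: "M 2 \<le> M'" "M 3 \<le> M'" "M 4 \<le> M'" "M' > 0"
    using M(1)[of 2] M(1)[of 3] M(1)[of 4] by (auto simp: M'_def)
  show ?thesis
  proof (rule that[OF \<open>M' > 0\<close>])
    fix z a b c d assume z: "z \<in> K"
    have mono: "A \<le> M m * X \<Longrightarrow> M m \<le> M' \<Longrightarrow> 0 \<le> X \<Longrightarrow> A \<le> M' * X" for A X m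
      by (meson mult_right_mono order_trans)
    show "\<bar>dir_deriv b (dir_deriv a F) z\<bar> \<le> M' * norm a * norm b"
      using mono[OF _ le(1)] M(2)[OF _ z, of 2 "[a, b]"] by (simp add: mult.assoc)
    show "\<bar>dir_deriv c (dir_deriv b (dir_deriv a F)) z\<bar> \<le> M' * norm a * norm b * norm c"
      using mono[OF _ le(2)] M(2)[OF _ z, of 3 "[a, b, c]"] by (simp add: mult.assoc)
    show "\<bar>dir_deriv d (dir_deriv c (dir_deriv b (dir_deriv a F))) z\<bar> \<le> M' * norm a * norm b * norm c * norm d"
      using mono[OF _ le(3)] M(2)[OF _ z, of 4 "[a, b, c, d]"] by (simp add: mult.assoc)
  qed
qed

lemma Ck_near_swap:
  fixes c :: "'a::euclidean_space \<Rightarrow> 'a \<Rightarrow> real"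
  assumes "Ck_near k (A \<times> B) (\<lambda>(x, y). c x y)"
  shows "Ck_near k (B \<times> A) (\<lambda>(y, x). c x y)"
proof -
  obtain W where W: "open W" "A \<times> B \<subseteq> W" "Ck_on k W (\<lambda>(x, y). c x y)"
    using assms by (auto simp: Ck_near_def)
  have T: "bounded_linear (prod.swap :: 'a \<times> 'a \<Rightarrow> _)"
    unfolding prod.swap_def by (intro bounded_linear_intros)
  have "open (prod.swap -` W)"
    by (intro open_vimage W linear_continuous_on T)
  moreover have "B \<times> A \<subseteq> prod.swap -` W"
    using W(2) by auto
  moreover have "Ck_on k (prod.swap -` W) (\<lambda>(y, x). c x y)"
    using Ck_on_linear_comp[OF W(1) T W(3)] by (simp add: case_prod_unfold)
  ultimately show ?thesis
    unfolding Ck_near_def by blast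
qed

section \<open>Gradients and diffeomorphisms\<close>

lemma functional_gradient:
  fixes L :: "'a::euclidean_space \<Rightarrow> real"
  assumes "linear L"
  obtains d where "\<And>h. L h = h \<bullet> d"
  using adjoint_works[OF assms, of _ 1] that by (metis inner_commute inner_real_def mult.right_neutral)

text \<open>Riesz representation provides a gradient vector and uniqueness of derivatives makes it
  the only one, so the \<open>THE\<close> in \<open>Dx\<close> and \<open>Dy\<close> denotes
  it.\<close>

lemma GDERIV_The:
  fixes f :: "'a::euclidean_space \<Rightarrow> real"
  assumes "(f has_derivative L) (at x)"
  shows "(THE d. GDERIV f x :> d) \<bullet> h = L h"
proof -
  obtain d where d: "\<And>h. L h = h \<bullet> d"
    using functional_gradient has_derivative_linear[OF assms] by blast
  have "GDERIV f x :> d"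
    using assms ext[of L "\<lambda>h. h \<bullet> d", OF d] by (simp add: gderiv_def)
  moreover have "d' = d" if "GDERIV f x :> d'" for d'
  proof -
    have "(\<lambda>h. h \<bullet> d') = L"
      using that assms has_derivative_unique unfolding gderiv_def by blast
    then show ?thesis
      using d by (metis vector_eq_rdot inner_commute)
  qed
  ultimately have "(THE d. GDERIV f x :> d) = d"
    by blast
  then show ?thesis
    by (simp add: d inner_commute)
qed

lemma Dx_inner:
  fixes c :: "'a::euclidean_space \<Rightarrow> 'b::euclidean_space \<Rightarrow> real"
  assumes "Ck_on (Suc k) W (\<lambda>(x, y). c x y)" "(x, y) \<in> W"
  shows "Dx c x y \<bullet> h = dir_deriv (h, 0) (\<lambda>(x, y). c x y) (x, y)"
proof -
  have "((\<lambda>x'. (x', y)) has_derivative (\<lambda>h. (h, 0))) (at x)"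
    by (auto intro!: derivative_eq_intros)
  from has_derivative_compose[OF this has_derivative_dir_deriv[OF assms]]
  show ?thesis
    unfolding Dx_def by (intro GDERIV_The) simp
qed

lemma Dy_inner:
  fixes c :: "'a::euclidean_space \<Rightarrow> 'b::euclidean_space \<Rightarrow> real"
  assumes "Ck_on (Suc k) W (\<lambda>(x, y). c x y)" "(x, y) \<in> W"
  shows "Dy c x y \<bullet> h = dir_deriv (0, h) (\<lambda>(x, y). c x y) (x, y)"
proof -
  have "((\<lambda>y'. (x, y')) has_derivative (\<lambda>h. (0, h))) (at y)"
    by (auto intro!: derivative_eq_intros)
  from has_derivative_compose[OF this has_derivative_dir_deriv[OF assms]]
  show ?thesis
    unfolding Dy_def by (intro GDERIV_The) simp
qed

section \<open>Diffeomorphisms onto their range: expansion, derivatives and curves\<close>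

lemma Ck_near_has_derivative:
  assumes "Ck_near (Suc k) S f" "x \<in> S"
  shows "(f has_derivative (\<lambda>v. dir_deriv v f x)) (at x)"
  using assms has_derivative_dir_deriv unfolding Ck_near_def by (metis subsetD)

lemma diffeo_onto_range_has_derivative:
  assumes "diffeo_onto_range S f" "x \<in> S"
  shows "(f has_derivative (\<lambda>v. dir_deriv v f x)) (at x)"
  using assms Ck_near_has_derivative[of 0] by (auto simp: diffeo_onto_range_def)

lemma diffeo_onto_range_continuous:
  assumes "diffeo_onto_range S f"
  shows "continuous_on S f"
  by (meson assms diffeo_onto_range_has_derivative continuous_at_imp_continuous_on has_derivative_continuous)

lemma diffeo_onto_range_inj: "diffeo_onto_range S f \<Longrightarrow> inj_on f S"
  unfolding diffeo_onto_range_def by (metis inj_onI)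

text \<open>The left inverse is differentiable at \<open>f y\<close>, hence Lipschitz at that point.
  Smallness is asked of \<open>f y' - f y\<close> and not of \<open>y' - y\<close>: this is what
  later forces \<open>y'\<close> to be near \<open>y\<close>.\<close>

lemma diffeo_onto_range_expansive:
  assumes "diffeo_onto_range S f" "y \<in> S"
  obtains L d where "L > 0" "d > 0"
    "\<And>y'. y' \<in> S \<Longrightarrow> norm (f y' - f y) < d \<Longrightarrow> norm (y' - y) \<le> L * norm (f y' - f y)"
proof -
  obtain G where G: "Ck_near (Suc 0) (f ` S) G" "\<And>x. x \<in> S \<Longrightarrow> G (f x) = x"
    using assms by (auto simp: diffeo_onto_range_def)
  define G' where "G' = (\<lambda>v. dir_deriv v G (f y))"
  have der: "(G has_derivative G') (at (f y))"
    unfolding G'_def using Ck_near_has_derivative[OF G(1)] assms by blast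
  obtain B where B: "B > 0" "\<And>v. norm (G' v) \<le> norm v * B"
    using bounded_linear.pos_bounded[OF has_derivative_bounded_linear[OF der]] by blast
  obtain d where d: "d > 0" "\<And>z. norm (z - f y) < d \<Longrightarrow> norm (G z - G (f y) - G' (z - f y)) \<le> norm (z - f y)"
    using der unfolding has_derivative_at_alt by (metis mult_1 zero_less_one)
  show ?thesis
  proof (rule that[of "B + 1" d])
    fix y' assume y': "y' \<in> S" "norm (f y' - f y) < d"
    have "norm (y' - y) = norm ((G (f y') - G (f y) - G' (f y' - f y)) + G' (f y' - f y))"
      using G(2) y' assms by simp
    also have "\<dots> \<le> norm (f y' - f y) + norm (f y' - f y) * B"
      by (rule order_trans[OF norm_triangle_ineq add_mono[OF d(2)[OF y'(2)] B(2)]])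
    finally show "norm (y' - y) \<le> (B + 1) * norm (f y' - f y)"
      by (simp add: algebra_simps)
  qed (use B d in auto)
qed

text \<open>At a boundary point the left inverse is only known on one side, so injectivity of the
  derivative is obtained as a limit of a uniform lower bound at interior points.\<close>

lemma diffeo_onto_range_deriv_nonzero:
  assumes f: "diffeo_onto_range (closure B) f" and "open B" "y \<in> closure B" "v \<noteq> 0"
  shows "dir_deriv v f y \<noteq> 0"
proof -
  obtain G where G: "Ck_near 1 (f ` closure B) G" "\<And>x. x \<in> closure B \<Longrightarrow> G (f x) = x"
    using f by (auto simp: diffeo_onto_range_def)
  obtain WG where WG: "open WG" "f ` closure B \<subseteq> WG" "Ck_on 1 WG G"
    using G(1) by (auto simp: Ck_near_def)
  obtain Wf where Wf: "open Wf" "closure B \<subseteq> Wf" "Ck_on 1 Wf f"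
    using f by (auto simp: diffeo_onto_range_def Ck_near_def)
  have "f y \<in> WG"
    using WG assms by auto
  then obtain r where r: "r > 0" "cball (f y) r \<subseteq> WG"
    using WG(1) open_contains_cball by blast
  obtain M where M: "M \<ge> 0" "\<And>z vs. z \<in> cball (f y) r \<Longrightarrow> length vs = 1 \<Longrightarrow>
      norm (fold dir_deriv vs G z) \<le> M * (\<Prod>v\<leftarrow>vs. norm v)"
    using Ck_on_compact_bound[OF WG(1) compact_cball r(2) WG(3)] by blast
  obtain s where s: "\<And>n. s n \<in> B" "s \<longlonglongrightarrow> y"
    using \<open>y \<in> closure B\<close> closure_sequential by blast
  have "isCont f y"
    using diffeo_onto_range_has_derivative[OF f \<open>y \<in> closure B\<close>] has_derivative_continuous by blast
  then have "(\<lambda>n. f (s n)) \<longlonglongrightarrow> f y"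
    by (rule isCont_tendsto_compose[OF _ s(2)])
  then have "\<forall>\<^sub>F n in sequentially. dist (f (s n)) (f y) < r"
    using r(1) by (rule tendstoD)
  then have ev: "\<forall>\<^sub>F n in sequentially. f (s n) \<in> cball (f y) r"
    by (rule eventually_mono) (simp add: dist_commute)
  \<comment> \<open>On the open set \<open>B\<close> the left inverse undoes \<open>f\<close> in a
    neighbourhood of \<open>x\<close>, so by the chain rule the derivative of \<open>G\<close> sends
    \<open>dir_deriv v f x\<close> back to \<open>v\<close>; \<open>M\<close> bounds that derivative
    uniformly near \<open>f y\<close>.\<close>
  have low: "norm v \<le> M * norm (dir_deriv v f x)" if x: "x \<in> B" "f x \<in> cball (f y) r" for x
  proof -
    have xc: "x \<in> closure B"
      using x closure_subset by blast
    have "((\<lambda>x. G (f x)) has_derivative (\<lambda>v. dir_deriv (dir_deriv v f x) G (f x))) (at x)"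
      using diffeo_onto_range_has_derivative[OF f xc] Ck_near_has_derivative[of 0 "f ` closure B" G "f x"] G(1) xc
      by (intro has_derivative_compose[of f _ x UNIV G]) auto
    from has_derivative_unique[OF this]
    have "(\<lambda>v. dir_deriv (dir_deriv v f x) G (f x)) = (\<lambda>v. v)"
      if "((\<lambda>x. G (f x)) has_derivative (\<lambda>v. v)) (at x)"
      using that .
    moreover have "((\<lambda>x. G (f x)) has_derivative (\<lambda>v. v)) (at x)"
      by (rule has_derivative_transform_within_open[OF has_derivative_ident \<open>open B\<close> x(1)])
        (use G(2) closure_subset in force)
    ultimately have "dir_deriv (dir_deriv v f x) G (f x) = v"
      by metis
    then show ?thesis
      using M(2)[OF x(2), of "[dir_deriv v f x]"] by simp
  qed
  have "continuous_on Wf (dir_deriv v f)"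
    using Ck_on_dir_deriv[of 0 Wf f] Wf(3) by simp
  then have "isCont (dir_deriv v f) y"
    using Wf assms continuous_on_eq_continuous_at by blast
  then have "(\<lambda>n. M * norm (dir_deriv v f (s n))) \<longlonglongrightarrow> M * norm (dir_deriv v f y)"
    by (intro tendsto_intros isCont_tendsto_compose[OF _ s(2)])
  moreover have "\<forall>\<^sub>F n in sequentially. norm v \<le> M * norm (dir_deriv v f (s n))"
    using ev low s(1) by (auto elim: eventually_mono)
  ultimately have "norm v \<le> M * norm (dir_deriv v f y)"
    by (rule tendsto_lowerbound) simp
  then show ?thesis
    using \<open>v \<noteq> 0\<close> by auto
qed

text \<open>A segment starting at \<open>f x\<close> is pulled back by the left inverse, whose
  derivative inverts that of \<open>f\<close>. The preimage thus leaves \<open>x\<close> in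
  direction \<open>v\<close> up to a small multiple of \<open>r\<close>, while its image stays
  exactly affine in \<open>r\<close>.\<close>

lemma diffeo_onto_range_curve:
  fixes f :: "'a::euclidean_space \<Rightarrow> 'a"
  assumes f: "diffeo_onto_range S f" and x: "x \<in> interior S" and "e > 0"
  obtains r0 where "r0 > 0" "\<And>r. 0 < r \<Longrightarrow> r < r0 \<Longrightarrow>
    \<exists>x'\<in>S. f x' = f x + r *\<^sub>R dir_deriv v f x \<and> norm (x' - x - r *\<^sub>R v) \<le> e * r"
proof -
  have xS: "x \<in> S"
    using x interior_subset by blast
  obtain G where G: "Ck_near (Suc 0) (f ` S) G" "\<And>x. x \<in> S \<Longrightarrow> G (f x) = x"
    using f by (auto simp: diffeo_onto_range_def)
  define G' where "G' = (\<lambda>v. dir_deriv v G (f x))"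
  define w where "w = dir_deriv v f x"
  have der: "(G has_derivative G') (at (f x))"
    unfolding G'_def using Ck_near_has_derivative[OF G(1)] xS by blast
  have "((\<lambda>x. G (f x)) has_derivative (\<lambda>v. G' (dir_deriv v f x))) (at x)"
    by (rule has_derivative_compose[OF diffeo_onto_range_has_derivative[OF f xS] der])
  from has_derivative_unique[OF this] have "(\<lambda>v. G' (dir_deriv v f x)) = (\<lambda>v. v)"
    if "((\<lambda>x. G (f x)) has_derivative (\<lambda>v. v)) (at x)"
    using that .
  moreover have "((\<lambda>x. G (f x)) has_derivative (\<lambda>v. v)) (at x)"
    by (rule has_derivative_transform_within_open[OF has_derivative_ident open_interior x])
      (use G(2) interior_subset in force)
  ultimately have G'w: "G' w = v"
    unfolding w_def by metis
  \<comment> \<open>Invariance of domain puts a full ball about \<open>f x\<close> into the image,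
    so the segment has preimages.\<close>
  have "open (f ` interior S)"
    by (meson f invariance_of_domain continuous_on_subset diffeo_onto_range_continuous
        diffeo_onto_range_inj inj_on_subset interior_subset open_interior)
  then obtain d1 where d1: "d1 > 0" "ball (f x) d1 \<subseteq> f ` interior S"
    using x open_contains_ball by blast
  define e' where "e' = e / (norm w + 1)"
  have "e' > 0"
    using \<open>e > 0\<close> by (simp add: e'_def add_nonneg_pos)
  obtain d2 where d2: "d2 > 0" "\<And>z. norm (z - f x) < d2 \<Longrightarrow>
      norm (G z - G (f x) - G' (z - f x)) \<le> e' * norm (z - f x)"
    using der \<open>e' > 0\<close> unfolding has_derivative_at_alt by metis
  define r0 where "r0 = min d1 d2 / (norm w + 1)"
  show ?thesis
  proof (rule that[of r0])
    show "r0 > 0"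
      using d1 d2 by (simp add: r0_def add_nonneg_pos)
    fix r :: real assume r: "0 < r" "r < r0"
    have "r * norm w \<le> r * (norm w + 1)"
      using r by simp
    also have "\<dots> < min d1 d2"
      using r add_nonneg_pos[of "norm w" 1] by (simp add: r0_def pos_less_divide_eq)
    finally have small: "norm (r *\<^sub>R w) < d1" "norm (r *\<^sub>R w) < d2"
      using r by auto
    have "f x + r *\<^sub>R w \<in> ball (f x) d1"
      using small by (simp add: dist_norm)
    then obtain x' where x': "x' \<in> interior S" "f x' = f x + r *\<^sub>R w"
      using d1 by (metis imageE subsetD)
    then have x'S: "x' \<in> S"
      using interior_subset by blast
    have "G' (r *\<^sub>R w) = r *\<^sub>R v"
      using linear_scale[OF has_derivative_linear[OF der]] G'w by simp
    then have "norm (x' - x - r *\<^sub>R v) \<le> e' * norm (r *\<^sub>R w)"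
      using d2(2)[of "f x'"] small x'(2) G(2)[OF x'S] G(2)[OF xS] by simp
    also have "\<dots> \<le> e * r"
    proof -
      have "e' * norm w \<le> e"
        using \<open>e > 0\<close> add_nonneg_pos[of "norm w" 1] by (simp add: e'_def field_simps)
      then show ?thesis
        using r by (simp add: mult.left_commute[of e'] mult.commute[of e])
    qed
    finally show "\<exists>x'\<in>S. f x' = f x + r *\<^sub>R dir_deriv v f x \<and> norm (x' - x - r *\<^sub>R v) \<le> e * r"
      using x' x'S by (auto simp: w_def)
  qed
qed

text \<open>Strong convexity constrains the image of \<open>B\<close> at its own frontier points.
  Invariance of domain makes that image open and injectivity keeps \<open>f y0\<close> outside it,
  so \<open>f y0\<close> is such a point. The ball is closed and therefore also contains the image
  of the closure.\<close>

lemma strongly_convex_image_ball: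
  fixes f :: "'a::euclidean_space \<Rightarrow> 'a"
  assumes f: "diffeo_onto_range (closure B) f" and "open B" and y0: "y0 \<in> frontier B"
    and "strongly_convex (f ` B)"
  obtains N R where "norm N = 1" "R > 0" "\<And>y. y \<in> closure B \<Longrightarrow> norm (f y - f y0 + R *\<^sub>R N) \<le> R"
proof -
  have cont: "continuous_on (closure B) f" and inj: "inj_on f (closure B)"
    using f diffeo_onto_range_continuous diffeo_onto_range_inj by auto
  have y0': "y0 \<in> closure B" "y0 \<notin> B"
    using y0 \<open>open B\<close> by (auto simp: frontier_def interior_open)
  have cl: "f ` closure B \<subseteq> closure (f ` B)"
    by (rule image_closure_subset[OF cont closed_closure closure_subset])
  have "open (f ` B)"
    by (rule invariance_of_domain[OF continuous_on_subset[OF cont closure_subset] \<open>open B\<close>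
          inj_on_subset[OF inj closure_subset]])
  moreover have "f y0 \<notin> f ` B"
    using inj_onD[OF inj] y0' closure_subset[of B] by blast
  ultimately have "f y0 \<in> frontier (f ` B)"
    using cl y0' by (auto simp: frontier_def interior_open)
  then obtain N R where NR: "norm N = 1" "R > 0" "f ` B \<subseteq> cball (f y0 - R *\<^sub>R N) R"
    using assms(4) unfolding strongly_convex_def by blast
  have sub: "closure (f ` B) \<subseteq> cball (f y0 - R *\<^sub>R N) R"
    by (rule closure_minimal[OF NR(3)]) simp
  have "norm (f y - f y0 + R *\<^sub>R N) \<le> R" if "y \<in> closure B" for y
  proof -
    have "f y \<in> cball (f y0 - R *\<^sub>R N) R"
      using sub cl that by blast
    then show ?thesis
      by (simp add: dist_norm norm_minus_commute algebra_simps)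
  qed
  then show ?thesis
    using that NR by blast
qed

section \<open>Images of balls near a boundary contact\<close>

text \<open>\<open>G\<close> is any relation monotone against \<open>(x0, y0)\<close>, so that the
  c-subdifferential and its converse both qualify. The quantifiers matter: \<open>x1\<close> and
  \<open>C\<close> are fixed before \<open>t\<close> and only \<open>e\<close> depends on
  \<open>t\<close>, so the slab becomes thin relative to the radius \<open>e\<close>.\<close>

lemma contact_image_in_slab:
  fixes A B :: "'a::euclidean_space set" and c :: "'a \<Rightarrow> 'a \<Rightarrow> real"
  defines "F \<equiv> \<lambda>(x, y). c x y"
  assumes c: "Ck_near 4 (closure A \<times> closure B) F"
    and q: "diffeo_onto_range (closure A) (\<lambda>x. - Dy c x y0)"
    and p: "diffeo_onto_range (closure B) (\<lambda>y. - Dx c x0 y)"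
    and "open B" "compact (closure B)"
    and x0: "x0 \<in> interior (closure A)" and y0: "y0 \<in> closure B"
    and N: "norm N = 1" and "R > 0"
    and ball: "\<And>y. y \<in> closure B \<Longrightarrow> norm (- Dx c x0 y + Dx c x0 y0 + R *\<^sub>R N) \<le> R"
    and G: "\<And>x y. (x, y) \<in> G \<Longrightarrow> x \<in> closure A \<and> y \<in> closure B \<and> c x y + c x0 y0 \<le> c x y0 + c x0 y"
    and "open O'" "x0 \<in> O'"
  obtains a x1 C where "a \<noteq> 0" "C > 0"
    "\<And>t. t > 0 \<Longrightarrow> \<exists>e>0. cball x1 e \<subseteq> O' \<and>
      G `` cball x1 e \<subseteq> {y. norm (y - y0) \<le> C * e \<and> \<bar>a \<bullet> (y - y0)\<bar> \<le> t * e}"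
proof -
  obtain W where W: "open W" "closure A \<times> closure B \<subseteq> W" and F: "Ck_on 4 W F"
    using c by (auto simp: Ck_near_def)
  have F3: "Ck_on (Suc 2) W (dir_deriv v F)" for v
    using F by (intro Ck_on_dir_deriv) simp
  have F4: "Ck_on (Suc 3) W F"
    using F by simp
  have F2: "Ck_on 2 W F"
    using Ck_on_mono[OF F] by simp
  have x0A: "x0 \<in> closure A"
    using x0 interior_subset by blast
  have W0: "(x0, y0) \<in> W"
    using W x0A y0 by blast
  have x0W: "(x0, y) \<in> W" if "y \<in> closure B" for y
    using W x0A that by blast
  have Fxy: "F (x, y) = c x y" for x y
    by (simp add: F_def)
  have Dx: "Dx c x y \<bullet> h = dir_deriv (h, 0) F (x, y)" if "(x, y) \<in> W" for x y h
    unfolding F_def using Dx_inner[of 3 W c] F4 that by (simp add: F_def)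
  have Dy: "Dy c x y \<bullet> h = dir_deriv (0, h) F (x, y)" if "(x, y) \<in> W" for x y h
    unfolding F_def using Dy_inner[of 3 W c] F4 that by (simp add: F_def)
  define w where "w = (\<lambda>y. - Dx c x0 y - - Dx c x0 y0)"
  define p' where "p' = (\<lambda>v. dir_deriv v (\<lambda>y. - Dx c x0 y) y0)"
  define q' where "q' = (\<lambda>v. dir_deriv v (\<lambda>x. - Dy c x y0) x0)"
  have p'_der: "((\<lambda>y. - Dx c x0 y) has_derivative p') (at y0)"
    unfolding p'_def by (rule diffeo_onto_range_has_derivative[OF p y0])
  have q'_der: "((\<lambda>x. - Dy c x y0) has_derivative q') (at x0)"
    unfolding q'_def by (rule diffeo_onto_range_has_derivative[OF q x0A])
  \<comment> \<open>\<open>p'\<close> and \<open>q'\<close> are the two readings of minus the mixed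
    second derivative of \<open>c\<close> at \<open>(x0, y0)\<close>.\<close>
  have p'_inner: "p' k \<bullet> h = - dir_deriv (0, k) (dir_deriv (h, 0) F) (x0, y0)" for k h
  proof -
    have "((\<lambda>y. (x0, y)) has_derivative (\<lambda>k. (0, k))) (at y0)"
      by (auto intro!: derivative_eq_intros)
    from has_derivative_compose[OF this has_derivative_dir_deriv[OF F3 W0]]
    have 1: "((\<lambda>y. - dir_deriv (h, 0) F (x0, y)) has_derivative
        (\<lambda>k. - dir_deriv (0, k) (dir_deriv (h, 0) F) (x0, y0))) (at y0)"
      by (rule has_derivative_minus)
    have "open ((\<lambda>y. (x0, y)) -` W)"
      by (intro open_vimage W continuous_intros)
    then have 2: "((\<lambda>y. - Dx c x0 y \<bullet> h) has_derivative
        (\<lambda>k. - dir_deriv (0, k) (dir_deriv (h, 0) F) (x0, y0))) (at y0)"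
      by (rule has_derivative_transform_within_open[OF 1]) (use W0 Dx in auto)
    have 3: "((\<lambda>y. - Dx c x0 y \<bullet> h) has_derivative (\<lambda>k. p' k \<bullet> h)) (at y0)"
      by (rule has_derivative_inner_left[OF p'_der])
    show ?thesis
      by (rule fun_cong[OF has_derivative_unique[OF 3 2]])
  qed
  have q'_inner: "q' h \<bullet> k = - dir_deriv (h, 0) (dir_deriv (0, k) F) (x0, y0)" for k h
  proof -
    have "((\<lambda>x. (x, y0)) has_derivative (\<lambda>k. (k, 0))) (at x0)"
      by (auto intro!: derivative_eq_intros)
    from has_derivative_compose[OF this has_derivative_dir_deriv[OF F3 W0]]
    have 1: "((\<lambda>x. - dir_deriv (0, k) F (x, y0)) has_derivative
        (\<lambda>h. - dir_deriv (h, 0) (dir_deriv (0, k) F) (x0, y0))) (at x0)"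
      by (rule has_derivative_minus)
    have "open ((\<lambda>x. (x, y0)) -` W)"
      by (intro open_vimage W continuous_intros)
    then have 2: "((\<lambda>x. - Dy c x y0 \<bullet> k) has_derivative
        (\<lambda>h. - dir_deriv (h, 0) (dir_deriv (0, k) F) (x0, y0))) (at x0)"
      by (rule has_derivative_transform_within_open[OF 1]) (use W0 Dy in auto)
    have 3: "((\<lambda>x. - Dy c x y0 \<bullet> k) has_derivative (\<lambda>h. q' h \<bullet> k)) (at x0)"
      by (rule has_derivative_inner_left[OF q'_der])
    show ?thesis
      by (rule fun_cong[OF has_derivative_unique[OF 3 2]])
  qed
  \<comment> \<open>By symmetry of second derivatives \<open>p'\<close> and \<open>q'\<close> are
    adjoint, so \<open>a\<close> represents the linearisation of \<open>w y \<bullet> N\<close> at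
    \<open>y0\<close>. It is nonzero because \<open>p'\<close> is injective, hence onto, and takes
    the value \<open>N\<close>.\<close>
  define a where "a = q' N"
  have a_inner: "a \<bullet> k = p' k \<bullet> N" for k
    unfolding a_def p'_inner q'_inner using dir_deriv_commute[OF F2 W(1) W0] by simp
  have "linear p'"
    by (rule has_derivative_linear[OF p'_der])
  moreover have "p' v \<noteq> 0" if "v \<noteq> 0" for v
    unfolding p'_def by (rule diffeo_onto_range_deriv_nonzero[OF p \<open>open B\<close> y0 that])
  then have "inj p'"
    by (auto simp: linear_injective_0[OF \<open>linear p'\<close>])
  ultimately have "surj p'"
    by (simp add: linear_injective_imp_surjective)
  then obtain k where "p' k = N"
    by (auto dest: surjD[of p' N])
  then have "a \<bullet> k = 1"
    using a_inner N by (simp add: norm_eq_1)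
  then have "a \<noteq> 0"
    by auto

  obtain L d where L: "L > 0" and d: "d > 0"
    and exp: "\<And>y. y \<in> closure B \<Longrightarrow> norm (w y) < d \<Longrightarrow> norm (y - y0) \<le> L * norm (w y)"
    unfolding w_def by (rule diffeo_onto_range_expansive[OF p y0]) blast
  \<comment> \<open>Squaring the ball inequality bounds \<open>w y\<close> quadratically by its
    inward normal component; this is the form in which strong convexity enters.\<close>
  have w_bd: "(norm (w y))\<^sup>2 \<le> - 2 * R * (w y \<bullet> N)" "norm (w y) \<le> 2 * R" if "y \<in> closure B" for y
  proof -
    have le: "norm (w y + R *\<^sub>R N) \<le> R"
      using ball[OF that] by (simp add: w_def)
    then have "(norm (w y + R *\<^sub>R N))\<^sup>2 \<le> R\<^sup>2"
      by (simp add: power_mono)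
    moreover have "(norm (w y + R *\<^sub>R N))\<^sup>2 = (norm (w y))\<^sup>2 + 2 * R * (w y \<bullet> N) + R\<^sup>2"
      using N unfolding power2_norm_eq_inner
      by (simp add: inner_simps norm_eq_1 power2_eq_square inner_commute algebra_simps)
    ultimately show "(norm (w y))\<^sup>2 \<le> - 2 * R * (w y \<bullet> N)"
      by simp
    have "norm (w y) \<le> norm (w y + R *\<^sub>R N) + norm (R *\<^sub>R N)"
      by (metis add_diff_cancel norm_triangle_ineq4)
    then show "norm (w y) \<le> 2 * R"
      using le N \<open>R > 0\<close> by simp
  qed

  obtain d1 where d1: "d1 > 0" "cball x0 d1 \<subseteq> O' \<inter> interior (closure A)"
    using \<open>open O'\<close> \<open>x0 \<in> O'\<close> x0 mem_interior_cball[of x0 "O' \<inter> interior (closure A)"]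
    by (auto simp: interior_open)
  obtain P Q where PQ: "open P" "open Q" "(x0, y0) \<in> P \<times> Q" "P \<times> Q \<subseteq> W"
    using open_prod_elim[OF W(1) W0] by blast
  obtain d2 where d2: "d2 > 0" "cball x0 d2 \<subseteq> P"
    using PQ(1,3) mem_interior_cball[of x0 P] by (auto simp: interior_open)
  obtain d3 where d3: "d3 > 0" "cball y0 d3 \<subseteq> Q"
    using PQ(2,3) mem_interior_cball[of y0 Q] by (auto simp: interior_open)
  define \<delta> where "\<delta> = min d1 (min d2 d3)"
  have "\<delta> > 0" and \<delta>_le: "\<delta> \<le> d1" "\<delta> \<le> d2" "\<delta> \<le> d3"
    using d1 d2 d3 by (auto simp: \<delta>_def)
  let ?X = "cball x0 \<delta>"
  \<comment> \<open>\<open>closure B\<close> need not be convex, so segments from \<open>y0\<close>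
    to nearby points are kept inside the added ball.\<close>
  define Y where "Y = closure B \<union> cball y0 \<delta>"
  have X: "?X \<subseteq> closure A" "?X \<subseteq> P" "?X \<subseteq> O'"
    using d1 d2 \<delta>_le interior_subset[of "closure A"] subset_cball[of \<delta> _ x0] by blast+
  have XY: "?X \<times> Y \<subseteq> W"
    using X d3 \<delta>_le subset_cball[of \<delta> d3 y0] W(2) PQ(4) unfolding Y_def by blast
  have "compact (?X \<times> Y)"
    unfolding Y_def using \<open>compact (closure B)\<close> by (intro compact_Times compact_Un) auto
  then obtain M where "M > 0"
    and M2: "\<And>z a b. z \<in> ?X \<times> Y \<Longrightarrow> \<bar>dir_deriv b (dir_deriv a F) z\<bar> \<le> M * norm a * norm b"
    and M3: "\<And>z a b c. z \<in> ?X \<times> Y \<Longrightarrow> \<bar>dir_deriv c (dir_deriv b (dir_deriv a F)) z\<bar> \<le> M * norm a * norm b * norm c"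
    and M4: "\<And>z a b c d. z \<in> ?X \<times> Y \<Longrightarrow>
      \<bar>dir_deriv d (dir_deriv c (dir_deriv b (dir_deriv a F))) z\<bar> \<le> M * norm a * norm b * norm c * norm d"
    using Ck_on_4_bounds[OF F W(1) _ XY] by blast
  have segX: "x + s *\<^sub>R (x' - x) \<in> ?X" if "x \<in> ?X" "x' \<in> ?X" "0 \<le> s" "s \<le> 1" for x x' s
    using convexD_alt[OF convex_cball[of x0 \<delta>] that] by (simp add: algebra_simps)
  have segY: "y0 + s *\<^sub>R (y - y0) \<in> cball y0 \<delta>" if "norm (y - y0) \<le> \<delta>" "0 \<le> s" "s \<le> 1" for y s
    using convexD_alt[OF convex_cball[of y0 \<delta>], of y0 y s] that \<open>\<delta> > 0\<close>
    by (simp add: algebra_simps dist_norm norm_minus_commute)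

  \<comment> \<open>This bound reaches all of \<open>closure B\<close> and is used before
    \<open>y\<close> is known to be near \<open>y0\<close>; \<open>E2\<close> to \<open>E5\<close>
    require that nearness.\<close>
  have E1: "\<bar>c x y - c x0 y - dir_deriv (x - x0, 0) F (x0, y)\<bar> \<le> M * (norm (x - x0))\<^sup>2"
    if x: "x \<in> ?X" and y: "y \<in> Y" for x y
  proof -
    have "(x0, y) + t *\<^sub>R (x - x0, 0) \<in> ?X \<times> Y" if "0 \<le> t" "t \<le> 1" for t
      using segX[of x0 x t] x y that \<open>\<delta> > 0\<close> by simp
    then show ?thesis
      using taylor_remainder_bound[OF F2, of "(x0, y)" "(x - x0, 0)" "M * (norm (x - x0))\<^sup>2"] XY
        M2[of _ "(x - x0, 0)" "(x - x0, 0)"]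
      by (simp add: Fxy power2_eq_square mult.assoc subset_iff)
  qed
  have E2: "\<bar>c x' y - c x' y0 - c x y + c x y0\<bar> \<le> M * norm (x' - x) * norm (y - y0)"
    if x: "x \<in> ?X" "x' \<in> ?X" and y: "norm (y - y0) \<le> \<delta>" for x x' y
  proof -
    have *: "(x, y0) + s *\<^sub>R (x' - x, 0) + t *\<^sub>R (0, y - y0) \<in> ?X \<times> Y" if "0 \<le> s" "s \<le> 1" "0 \<le> t" "t \<le> 1" for s t
      using segX[OF x, of s] segY[OF y, of t] that by (simp add: Y_def)
    obtain s t where st: "0 < s" "s < 1" "0 < t" "t < 1"
      "F ((x, y0) + (x' - x, 0) + (0, y - y0)) - F ((x, y0) + (x' - x, 0)) - F ((x, y0) + (0, y - y0)) + F (x, y0)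
        = dir_deriv (0, y - y0) (dir_deriv (x' - x, 0) F) ((x, y0) + s *\<^sub>R (x' - x, 0) + t *\<^sub>R (0, y - y0))"
      by (rule mixed_difference_MVT[OF F2 subsetD[OF XY *]])
    then show ?thesis
      using M2[OF *[of s t], of "(0, y - y0)" "(x' - x, 0)"] by (simp add: Fxy)
  qed
  \<comment> \<open>\<open>\<rho> h y\<close> is the Taylor remainder at \<open>y0\<close> of the
    \<open>x\<close>-derivative of \<open>c\<close> along \<open>h\<close>, linear in
    \<open>h\<close> and quadratically small in \<open>y - y0\<close>; \<open>\<psi> x y\<close> is
    the Taylor remainder of \<open>c\<close> itself in \<open>y\<close>.\<close>
  define \<rho> where "\<rho> = (\<lambda>h y. dir_deriv (h, 0) F (x0, y) - dir_deriv (h, 0) F (x0, y0)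
    - dir_deriv (h, 0) (dir_deriv (0, y - y0) F) (x0, y0))"
  define \<psi> where "\<psi> = (\<lambda>x y. c x y - c x y0 - dir_deriv (0, y - y0) F (x, y0))"
  have E3: "\<bar>\<psi> x y - \<psi> x0 y - \<rho> (x - x0) y\<bar> \<le> M * (norm (x - x0))\<^sup>2 * (norm (y - y0))\<^sup>2"
    if x: "x \<in> ?X" and y: "norm (y - y0) \<le> \<delta>" for x y
  proof -
    have *: "?X \<times> cball y0 \<delta> \<subseteq> ?X \<times> Y"
      by (auto simp: Y_def)
    have y': "y \<in> cball y0 \<delta>"
      using y by (simp add: dist_norm norm_minus_commute)
    have "\<bar>dir_deriv (0, y - y0) (dir_deriv (0, y - y0) (dir_deriv (x - x0, 0) (dir_deriv (x - x0, 0) F))) z\<bar>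
        \<le> M * (norm (x - x0))\<^sup>2 * (norm (y - y0))\<^sup>2" if "z \<in> ?X \<times> cball y0 \<delta>" for z
      using M4[of z "(0, y - y0)" "(0, y - y0)" "(x - x0, 0)" "(x - x0, 0)"] that *
      by (auto simp: power2_eq_square mult_ac)
    then show ?thesis
      using mixed_taylor_remainder[OF F W(1) order_trans[OF * XY] convex_cball convex_cball, of x0 "x - x0" y0 "y - y0"
          "M * (norm (x - x0))\<^sup>2 * (norm (y - y0))\<^sup>2"] x y' \<open>\<delta> > 0\<close>
      by (simp add: \<rho>_def \<psi>_def Fxy)
  qed
  have E4: "\<bar>\<rho> h y\<bar> \<le> M * norm h * (norm (y - y0))\<^sup>2" if y: "norm (y - y0) \<le> \<delta>" for h y
  proof -
    have *: "(x0, y0) + t *\<^sub>R (0, y - y0) \<in> ?X \<times> Y" if "0 \<le> t" "t \<le> 1" for t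
      using segY[OF y that] \<open>\<delta> > 0\<close> by (simp add: Y_def)
    have "\<bar>dir_deriv (h, 0) F ((x0, y0) + (0, y - y0)) - dir_deriv (h, 0) F (x0, y0)
        - dir_deriv (0, y - y0) (dir_deriv (h, 0) F) (x0, y0)\<bar> \<le> M * norm h * (norm (y - y0))\<^sup>2"
      using M3[OF *, of _ "(0, y - y0)" "(0, y - y0)" "(h, 0)"] *
      by (intro taylor_remainder_bound[OF Ck_on_mono[OF F3] subsetD[OF XY]])
        (simp_all add: power2_eq_square mult_ac)
    then show ?thesis
      using dir_deriv_commute[OF F2 W(1) W0, of "(0, y - y0)" "(h, 0)"] by (simp add: \<rho>_def)
  qed
  have \<rho>_linear: "linear (\<lambda>h. \<rho> h y)" if "y \<in> Y" for y
  proof -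
    have yW: "(x0, y) \<in> W"
      using XY that \<open>\<delta> > 0\<close> by auto
    have lin: "linear (\<lambda>h::'a. (h, 0 :: 'a))"
      by (auto intro!: linearI)
    note l = linear_compose[OF lin has_derivative_linear[OF has_derivative_dir_deriv], unfolded o_def]
    show ?thesis
      unfolding \<rho>_def by (intro linear_compose_sub l[OF F4 yW] l[OF F4 W0] l[OF F3 W0])
  qed

  \<comment> \<open>\<open>2 * \<theta> * L\<^sup>2 = 1 / (2 * R)\<close>, so near \<open>y0\<close>
    the quantity \<open>- (w y \<bullet> N)\<close> dominates
    \<open>2 * \<theta> * (norm (y - y0))\<^sup>2\<close>, twice the error allowed by
    \<open>E5\<close> per unit of \<open>r\<close>. The threshold \<open>\<sigma>\<close> brings
    \<open>y\<close> into the range of \<open>exp\<close> and within \<open>\<delta>\<close> of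
    \<open>y0\<close>.\<close>
  define \<theta> where "\<theta> = 1 / (4 * R * L\<^sup>2)"
  define \<sigma> where "\<sigma> = min d (\<delta> / L)"
  \<comment> \<open>The entries give, in turn, \<open>norm (x - x0) \<le> 2 * r\<close>, half of the
    error in \<open>E5\<close>, and one share of the localisation of \<open>w y\<close>.\<close>
  define \<eta> where "\<eta> = min (1/2) (min (\<theta> / (2 * M)) (\<sigma>\<^sup>2 / (16 * R\<^sup>2)))"
  have "\<theta> > 0" "\<sigma> > 0"
    using \<open>R > 0\<close> L d \<open>\<delta> > 0\<close> by (auto simp: \<theta>_def \<sigma>_def)
  have "\<eta> > 0"
    using \<open>\<theta> > 0\<close> \<open>\<sigma> > 0\<close> \<open>M > 0\<close> \<open>R > 0\<close> by (simp add: \<eta>_def)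
  have "\<eta> \<le> 1/2" and "\<eta> \<le> \<theta> / (2 * M)" and "\<eta> \<le> \<sigma>\<^sup>2 / (16 * R\<^sup>2)"
    by (auto simp: \<eta>_def)
  then have \<eta>_le: "\<eta> \<le> 1/2" "M * \<eta> \<le> \<theta> / 2" "4 * R * \<eta> \<le> \<sigma>\<^sup>2 / (4 * R)"
    using \<open>M > 0\<close> \<open>R > 0\<close> by (auto simp: field_simps power2_eq_square)
  obtain r0 where "r0 > 0" and r0: "\<And>r. 0 < r \<Longrightarrow> r < r0 \<Longrightarrow>
      \<exists>x'\<in>closure A. - Dy c x' y0 = - Dy c x0 y0 + r *\<^sub>R a \<and> norm (x' - x0 - r *\<^sub>R N) \<le> \<eta> * r"
    unfolding a_def q'_def by (rule diffeo_onto_range_curve[OF q x0 \<open>\<eta> > 0\<close>, of N]) blast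
  \<comment> \<open>The entries make the curve available, keep its point and the neighbours in
    \<open>?X\<close>, pay the other share of the localisation, and pay the other half of the error
    in \<open>E5\<close>.\<close>
  define r where "r = min (r0 / 2) (min (\<delta> / 2) (min (\<sigma>\<^sup>2 / (64 * M * R)) (\<theta> / (8 * M))))"
  have "r > 0"
    using \<open>r0 > 0\<close> \<open>\<theta> > 0\<close> \<open>\<sigma> > 0\<close> \<open>M > 0\<close> \<open>R > 0\<close> \<open>\<delta> > 0\<close> by (simp add: r_def)
  have "r \<le> r0 / 2" "r \<le> \<delta> / 2" "r \<le> \<sigma>\<^sup>2 / (64 * M * R)" "r \<le> \<theta> / (8 * M)"
    by (auto simp: r_def)
  then have r_le: "r < r0" "2 * r \<le> \<delta>" "8 * M * r \<le> \<sigma>\<^sup>2 / (8 * R)" "4 * M * r \<le> \<theta> / 2"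
    using \<open>M > 0\<close> \<open>R > 0\<close> \<open>r0 > 0\<close> by (auto simp: field_simps)
  obtain x1 where x1: "x1 \<in> closure A" "- Dy c x1 y0 = - Dy c x0 y0 + r *\<^sub>R a"
    "norm (x1 - x0 - r *\<^sub>R N) \<le> \<eta> * r"
    using r0[OF \<open>r > 0\<close> r_le(1)] by blast
  \<comment> \<open>The tolerance \<open>2 * \<eta> * r\<close> covers \<open>x1\<close> as well as
    all points within \<open>\<eta> * r\<close> of it.\<close>
  have tri: "norm h \<le> 2 * r" if "norm (h - r *\<^sub>R N) \<le> 2 * \<eta> * r" for h
  proof -
    have "norm h \<le> norm (h - r *\<^sub>R N) + norm (r *\<^sub>R N)"
      by (metis diff_add_cancel norm_triangle_ineq)
    also have "\<dots> \<le> 2 * \<eta> * r + r"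
      using that N \<open>r > 0\<close> by simp
    also have "2 * \<eta> * r \<le> 1 * r"
      using \<eta>_le \<open>r > 0\<close> by (intro mult_right_mono) auto
    finally show ?thesis
      by simp
  qed
  have "\<eta> * r > 0"
    using \<open>\<eta> > 0\<close> \<open>r > 0\<close> by simp
  then have h1: "norm (x1 - x0) \<le> 2 * r"
    using x1(3) by (intro tri) simp
  have x1X: "x1 \<in> ?X"
    using h1 r_le by (simp add: dist_norm norm_minus_commute)

  have w_N: "w y \<bullet> N = - \<rho> N y + a \<bullet> (y - y0)" if y: "y \<in> closure B" for y
    using Dx[OF x0W[OF y], of N] Dx[OF W0, of N] q'_inner[of N "y - y0"]
    by (simp add: w_def \<rho>_def a_def inner_diff_left inner_add_left)
  text \<open>The choice of \<open>x1\<close> cancels the part linear in \<open>y - y0\<close> exactly; a remainder \<open>o(r) |y - y0|\<close>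
    would not be absorbed by strong convexity.\<close>
  have E5: "\<bar>c x1 y - c x1 y0 - c x0 y + c x0 y0 + r * (w y \<bullet> N)\<bar> \<le> \<theta> * r * (norm (y - y0))\<^sup>2"
    if y: "y \<in> closure B" and near: "norm (y - y0) \<le> \<delta>" for y
  proof -
    let ?h = "x1 - x0" and ?k = "y - y0"
    have W1: "(x1, y0) \<in> W"
      using W x1 y0 by blast
    have "dir_deriv (0, ?k) F (x1, y0) - dir_deriv (0, ?k) F (x0, y0) = - r * (a \<bullet> ?k)"
      unfolding Dy[OF W1, symmetric] Dy[OF W0, symmetric]
      using arg_cong[OF x1(2), of "\<lambda>v. v \<bullet> ?k"] by (simp add: inner_add_left inner_diff_left)
    moreover have "\<rho> (?h - r *\<^sub>R N) y = \<rho> ?h y - r * \<rho> N y"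
      using linear_diff[OF \<rho>_linear[of y], of ?h "r *\<^sub>R N"] linear_scale[OF \<rho>_linear[of y], of r N] y
      by (simp add: Y_def)
    ultimately have "c x1 y - c x1 y0 - c x0 y + c x0 y0 + r * (w y \<bullet> N)
        = (\<psi> x1 y - \<psi> x0 y - \<rho> ?h y) + \<rho> (?h - r *\<^sub>R N) y"
      unfolding w_N[OF y] \<psi>_def by (simp add: algebra_simps)
    also have "\<bar>\<dots>\<bar> \<le> M * (norm ?h)\<^sup>2 * (norm ?k)\<^sup>2 + M * norm (?h - r *\<^sub>R N) * (norm ?k)\<^sup>2"
      using E3[OF x1X near] E4[OF near, of "?h - r *\<^sub>R N"] by linarith
    also have "\<dots> = (M * (norm ?h)\<^sup>2 + M * norm (?h - r *\<^sub>R N)) * (norm ?k)\<^sup>2"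
      by (simp add: algebra_simps)
    also have "\<dots> \<le> \<theta> * r * (norm ?k)\<^sup>2"
    proof (rule mult_right_mono)
      have "M * (norm ?h)\<^sup>2 \<le> M * (2 * r)\<^sup>2"
        using h1 \<open>M > 0\<close> by (intro mult_left_mono power_mono) auto
      also have "\<dots> = 4 * M * r * r"
        by (simp add: power2_eq_square)
      also have "\<dots> \<le> \<theta> / 2 * r"
        using r_le \<open>r > 0\<close> by (intro mult_right_mono) auto
      finally have 1: "M * (norm ?h)\<^sup>2 \<le> \<theta> / 2 * r" .
      have "M * norm (?h - r *\<^sub>R N) \<le> M * (\<eta> * r)"
        using x1(3) \<open>M > 0\<close> by (intro mult_left_mono) auto
      also have "\<dots> = M * \<eta> * r"
        by simp
      also have "\<dots> \<le> \<theta> / 2 * r"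
        using \<eta>_le \<open>r > 0\<close> by (intro mult_right_mono) auto
      finally show "M * (norm ?h)\<^sup>2 + M * norm (?h - r *\<^sub>R N) \<le> \<theta> * r"
        using 1 by (simp add: field_simps)
    qed simp
    finally show ?thesis .
  qed

  \<comment> \<open>The constant left after cancelling in \<open>\<theta> * r * (norm (y -
    y0))\<^sup>2 \<le> M * e * norm (y - y0)\<close>.\<close>
  define C where "C = M / (\<theta> * r)"
  have "C > 0"
    using \<open>M > 0\<close> \<open>\<theta> > 0\<close> \<open>r > 0\<close> by (simp add: C_def)
  have image: "norm (y - y0) \<le> \<delta>" "norm (y - y0) \<le> C * e" "\<bar>w y \<bullet> N\<bar> \<le> 2 * M * C / r * e\<^sup>2"
    if e: "0 < e" "e \<le> \<eta> * r" and x: "x \<in> cball x1 e" and xy: "(x, y) \<in> G" for e x y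
  proof -
    have y: "y \<in> closure B" and le: "c x y + c x0 y0 \<le> c x y0 + c x0 y"
      using G[OF xy] by auto
    have xx1: "norm (x - x1) \<le> e"
      using x by (simp add: dist_norm norm_minus_commute)
    let ?h = "x - x0" and ?k = "y - y0"
    have "norm (?h - r *\<^sub>R N) \<le> norm (x - x1) + norm (x1 - x0 - r *\<^sub>R N)"
      using norm_triangle_ineq[of "x - x1" "x1 - x0 - r *\<^sub>R N"] by (simp add: algebra_simps)
    then have he: "norm (?h - r *\<^sub>R N) \<le> 2 * \<eta> * r"
      using xx1 e x1(3) by simp
    have h: "norm ?h \<le> 2 * r"
      by (rule tri[OF he])
    then have xX: "x \<in> ?X"
      using r_le by (simp add: dist_norm norm_minus_commute)
    have N_neg: "(norm (w y))\<^sup>2 / (2 * R) \<le> - (w y \<bullet> N)"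
      using w_bd(1)[OF y] \<open>R > 0\<close> by (simp add: field_simps)
    \<comment> \<open>Coarse localisation: monotonicity of \<open>G\<close> and \<open>E1\<close> at
      \<open>y\<close> and at \<open>y0\<close> bound \<open>- (w y \<bullet> ?h)\<close> by a term
      quadratic in \<open>r\<close>. Replacing \<open>?h\<close> by \<open>r *\<^sub>R N\<close>
      costs a term with the factor \<open>\<eta> * r\<close>, and after division by \<open>r\<close>
      both are small.\<close>
    have "norm (w y) < \<sigma>"
    proof -
      have "dir_deriv (?h, 0) F (x0, y) - dir_deriv (?h, 0) F (x0, y0) = - (w y \<bullet> ?h)"
        using Dx[OF x0W[OF y], of ?h] Dx[OF W0, of ?h] by (simp add: w_def inner_diff_left inner_add_left)
      then have "- (w y \<bullet> ?h) \<le> 2 * M * (norm ?h)\<^sup>2"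
        using E1[OF xX, of y] E1[OF xX, of y0] y y0 le by (simp add: Y_def abs_le_iff)
      also have "\<dots> \<le> 2 * M * (2 * r)\<^sup>2"
        using h \<open>M > 0\<close> by (intro mult_left_mono power_mono) auto
      finally have 1: "- (w y \<bullet> ?h) \<le> r * (8 * M * r)"
        by (simp add: power2_eq_square algebra_simps)
      have "w y \<bullet> (?h - r *\<^sub>R N) \<le> norm (w y) * norm (?h - r *\<^sub>R N)"
        by (rule norm_cauchy_schwarz)
      also have "\<dots> \<le> (2 * R) * (2 * \<eta> * r)"
        using w_bd(2)[OF y] he \<open>R > 0\<close> by (intro mult_mono) auto
      finally have "w y \<bullet> ?h - r * (w y \<bullet> N) \<le> r * (4 * R * \<eta>)"
        by (simp add: inner_diff_right algebra_simps)
      then have "r * (- (w y \<bullet> N)) \<le> r * (8 * M * r + 4 * R * \<eta>)"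
        using 1 by (simp add: algebra_simps)
      then have "- (w y \<bullet> N) \<le> 8 * M * r + 4 * R * \<eta>"
        using \<open>r > 0\<close> mult_le_cancel_left_pos by blast
      then have "(norm (w y))\<^sup>2 / (2 * R) \<le> \<sigma>\<^sup>2 / (8 * R) + \<sigma>\<^sup>2 / (4 * R)"
        using N_neg r_le \<eta>_le by linarith
      then have "(norm (w y))\<^sup>2 \<le> 3 / 4 * \<sigma>\<^sup>2"
        using \<open>R > 0\<close> by (simp add: field_simps)
      also have "\<dots> < \<sigma>\<^sup>2"
        using \<open>\<sigma> > 0\<close> by simp
      finally show ?thesis
        using \<open>\<sigma> > 0\<close> by (simp add: power2_less_imp_less)
    qed
    then have "norm (w y) < d" "L * norm (w y) \<le> \<delta>"
      using L by (auto simp: \<sigma>_def field_simps)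
    then have k: "norm ?k \<le> L * norm (w y)"
      using exp[OF y] by blast
    then show near: "norm ?k \<le> \<delta>"
      using \<open>L * norm (w y) \<le> \<delta>\<close> by simp
    have "(norm ?k)\<^sup>2 \<le> (L * norm (w y))\<^sup>2"
      using k by (intro power_mono) auto
    then have "2 * \<theta> * (norm ?k)\<^sup>2 \<le> 2 * \<theta> * (L * norm (w y))\<^sup>2"
      using \<open>\<theta> > 0\<close> by (intro mult_left_mono) auto
    also have "\<dots> = (norm (w y))\<^sup>2 / (2 * R)"
      using L \<open>R > 0\<close> by (simp add: \<theta>_def power_mult_distrib)
    finally have low: "2 * \<theta> * (norm ?k)\<^sup>2 \<le> - (w y \<bullet> N)"
      using N_neg by simp
    have "M * norm (x - x1) * norm ?k \<le> M * e * norm ?k"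
      using xx1 \<open>M > 0\<close> by (intro mult_right_mono mult_left_mono) auto
    \<comment> \<open>By \<open>E2\<close>, passing from \<open>x1\<close> to \<open>x\<close>
      changes the mixed difference by at most \<open>M * e * norm ?k\<close>, and at
      \<open>x\<close> its sign is known from \<open>le\<close>.\<close>
    then have up: "r * (- (w y \<bullet> N)) \<le> M * e * norm ?k + \<theta> * r * (norm ?k)\<^sup>2"
      using E5[OF y near] E2[OF x1X xX near] le by linarith
    have "r * (2 * \<theta> * (norm ?k)\<^sup>2) \<le> r * (- (w y \<bullet> N))"
      using low \<open>r > 0\<close> by (intro mult_left_mono) auto
    \<comment> \<open>The quadratic error is half of the lower bound from \<open>low\<close>, so one
      copy of it survives on the left.\<close>
    with up have small: "\<theta> * r * (norm ?k)\<^sup>2 \<le> M * e * norm ?k"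
      by (simp add: algebra_simps)
    show kC: "norm ?k \<le> C * e"
    proof (cases "norm ?k = 0")
      case False
      then have "\<theta> * r * norm ?k \<le> M * e"
        using small by (simp add: power2_eq_square)
      then show ?thesis
        using \<open>\<theta> > 0\<close> \<open>r > 0\<close> by (simp add: C_def field_simps)
    qed (use \<open>C > 0\<close> e in simp)
    have "r * (- (w y \<bullet> N)) \<le> 2 * (M * e * norm ?k)"
      using up small by simp
    also have "\<dots> \<le> 2 * (M * e * (C * e))"
      using kC \<open>M > 0\<close> e by (intro mult_left_mono) auto
    finally have "- (w y \<bullet> N) \<le> 2 * M * C / r * e\<^sup>2"
      using \<open>r > 0\<close> by (simp add: field_simps power2_eq_square)
    moreover have "w y \<bullet> N \<le> 0"
      using low \<open>\<theta> > 0\<close> by (smt (verit) mult_nonneg_nonneg zero_le_power2)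
    ultimately show "\<bar>w y \<bullet> N\<bar> \<le> 2 * M * C / r * e\<^sup>2"
      by simp
  qed

  have slab: "\<exists>e>0. cball x1 e \<subseteq> O' \<and>
      G `` cball x1 e \<subseteq> {y. norm (y - y0) \<le> C * e \<and> \<bar>a \<bullet> (y - y0)\<bar> \<le> t * e}" if "t > 0" for t
  proof -
    have "t / (2 * C) > 0"
      using \<open>t > 0\<close> \<open>C > 0\<close> by simp
    then obtain s where s: "s > 0" "\<And>y. norm (y - y0) < s \<Longrightarrow>
        norm (- Dx c x0 y - - Dx c x0 y0 - p' (y - y0)) \<le> t / (2 * C) * norm (y - y0)"
      using p'_der unfolding has_derivative_at_alt by meson
    have "x1 \<in> interior O'"
    proof -
      have "norm (x1 - x0) \<le> d1"
        using h1 r_le \<delta>_le by simp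
      then have "x1 \<in> O'"
        using d1 by (auto simp: dist_norm norm_minus_commute)
      then show ?thesis
        using \<open>open O'\<close> by (simp add: interior_open)
    qed
    then obtain e1 where e1: "e1 > 0" "cball x1 e1 \<subseteq> O'"
      by (meson mem_interior_cball)
    \<comment> \<open>The entries keep the ball in \<open>O'\<close>, allow \<open>image\<close>,
      bring \<open>C * e\<close> below the range \<open>s\<close> of the linearisation, and bound
      the quadratic term by \<open>t * e / 2\<close>; the linearisation error takes the other
      half.\<close>
    define e where "e = min e1 (min (\<eta> * r) (min (s / (2 * C)) (t * r / (4 * M * C))))"
    have "e > 0"
      using e1 \<open>\<eta> * r > 0\<close> s \<open>t > 0\<close> \<open>r > 0\<close> \<open>M > 0\<close> \<open>C > 0\<close> by (simp add: e_def)
    have e_le: "e \<le> e1" "e \<le> \<eta> * r" "e \<le> s / (2 * C)" "e \<le> t * r / (4 * M * C)"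
      by (auto simp: e_def)
    have "norm (y - y0) \<le> C * e \<and> \<bar>a \<bullet> (y - y0)\<bar> \<le> t * e" if "x \<in> cball x1 e" "(x, y) \<in> G" for x y
    proof
      note im = image[OF \<open>e > 0\<close> e_le(2) that]
      show k: "norm (y - y0) \<le> C * e"
        by (rule im)
      have "C * e < s"
        using e_le(3) \<open>C > 0\<close> s(1) by (simp add: field_simps)
      then have "norm (w y - p' (y - y0)) \<le> t / (2 * C) * norm (y - y0)"
        using s(2)[of y] k by (simp add: w_def)
      also have "\<dots> \<le> t / (2 * C) * (C * e)"
        using k \<open>t / (2 * C) > 0\<close> by (intro mult_left_mono) auto
      finally have 1: "norm (w y - p' (y - y0)) \<le> t * e / 2"
        using \<open>C > 0\<close> by simp
      have "\<bar>w y \<bullet> N - a \<bullet> (y - y0)\<bar> = \<bar>(w y - p' (y - y0)) \<bullet> N\<bar>"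
        by (simp add: a_inner inner_diff_left)
      also have "\<dots> \<le> norm (w y - p' (y - y0)) * norm N"
        by (rule Cauchy_Schwarz_ineq2)
      finally have 2: "\<bar>w y \<bullet> N - a \<bullet> (y - y0)\<bar> \<le> t * e / 2"
        using 1 N by simp
      have "2 * M * C / r * e\<^sup>2 = (2 * M * C / r * e) * e"
        by (simp add: power2_eq_square)
      also have "\<dots> \<le> t / 2 * e"
        using e_le(4) \<open>C > 0\<close> \<open>M > 0\<close> \<open>r > 0\<close> \<open>e > 0\<close> by (intro mult_right_mono) (auto simp: field_simps)
      finally have "\<bar>w y \<bullet> N\<bar> \<le> t * e / 2"
        using im(3) by simp
      then show "\<bar>a \<bullet> (y - y0)\<bar> \<le> t * e"
        using 2 by (smt (verit) field_sum_of_halves)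
    qed
    moreover have "cball x1 e \<subseteq> O'"
      using e1 e_le subset_cball by blast
    ultimately show ?thesis
      using \<open>e > 0\<close> by blast
  qed
  show ?thesis
    by (rule that[OF \<open>a \<noteq> 0\<close> \<open>C > 0\<close> slab])
qed

section \<open>Volume of thin slabs and rescaling\<close>

lemma thin_slab_emeasure:
  fixes a :: "'a::euclidean_space"
  assumes "a \<noteq> 0" "e > 0"
  obtains t where "t > 0" "emeasure lebesgue {k. norm k \<le> C \<and> \<bar>a \<bullet> k\<bar> \<le> t} < e"
proof -
  let ?A = "\<lambda>i::nat. {k. norm k \<le> C \<and> \<bar>a \<bullet> k\<bar> \<le> 1 / Suc i}"
  have closed: "closed (?A i)" for i
    by (intro closed_Collect_conj closed_Collect_le continuous_intros)
  have sub: "?A i \<subseteq> cball 0 C" for i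
    by auto
  have comp: "compact (?A i)" for i
    using closed[of i] sub[of i] by (metis bounded_cball bounded_subset compact_eq_bounded_closed)
  \<comment> \<open>The slabs decrease to a subset of the hyperplane orthogonal to \<open>a\<close>,
    which is null; being bounded, they have finite measure, which gives continuity from
    above.\<close>
  have lim: "(\<lambda>i. emeasure lebesgue (?A i)) \<longlonglongrightarrow> emeasure lebesgue (\<Inter>i. ?A i)"
  proof (rule Lim_emeasure_decseq)
    show "range ?A \<subseteq> sets lebesgue"
      using closed by (auto intro!: sets_completionI_sets)
    have "1 / real (Suc j) \<le> 1 / real (Suc i)" if "i \<le> j" for i j
      using that by (simp add: frac_le)
    then show "decseq ?A"
      by (auto simp: decseq_def intro: order_trans)
    show "emeasure lebesgue (?A i) \<noteq> \<infinity>" for i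
      using fmeasurableD2[OF lmeasurable_compact[OF comp]] by (simp only: infinity_ennreal_def not_False_eq_True)
  qed
  have "k \<bullet> a = 0" if "k \<in> (\<Inter>i. ?A i)" for k
  proof (rule ccontr)
    assume "k \<bullet> a \<noteq> 0"
    then obtain n where "inverse (real (Suc n)) < \<bar>a \<bullet> k\<bar>"
      using reals_Archimedean[of "\<bar>a \<bullet> k\<bar>"] by (auto simp: inner_commute)
    moreover have "\<bar>a \<bullet> k\<bar> \<le> 1 / Suc n"
      using that by blast
    ultimately show False
      by (simp add: inverse_eq_divide)
  qed
  then have "(\<Inter>i. ?A i) \<subseteq> {k. a \<bullet> k = 0}"
    by (auto simp: inner_commute)
  then have "negligible (\<Inter>i. ?A i)"
    using negligible_subset[OF negligible_hyperplane[of a 0]] assms by simp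
  then have "emeasure lebesgue (\<Inter>i. ?A i) = 0"
    by (simp add: negligible_iff_emeasure0 negligible_imp_sets)
  with lim have "\<forall>\<^sub>F i in sequentially. emeasure lebesgue (?A i) < e"
    using order_tendstoD(2)[OF lim] assms by simp
  then obtain i where "emeasure lebesgue (?A i) < e"
    by (meson eventually_sequentially order_refl)
  then show ?thesis
    by (intro that[of "1 / Suc i"]) auto
qed

text \<open>The slab belonging to radius \<open>e\<close> is a translated \<open>e\<close>-dilate of
  one fixed slab, so its volume and that of the ball carry the same power of \<open>e\<close>, and
  \<open>t\<close> can be chosen before \<open>e\<close>. The measurable cover \<open>S\<close>
  stands in for the image, whose measurability is not assumed.\<close>

lemma contact_image_small:
  fixes A B :: "'a::euclidean_space set" and c :: "'a \<Rightarrow> 'a \<Rightarrow> real"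
  assumes "Ck_near 4 (closure A \<times> closure B) (\<lambda>(x, y). c x y)"
    and "diffeo_onto_range (closure A) (\<lambda>x. - Dy c x y0)"
    and "diffeo_onto_range (closure B) (\<lambda>y. - Dx c x0 y)"
    and "open B" "compact (closure B)"
    and "x0 \<in> interior (closure A)" "y0 \<in> closure B"
    and "norm N = 1" and "R > 0"
    and "\<And>y. y \<in> closure B \<Longrightarrow> norm (- Dx c x0 y + Dx c x0 y0 + R *\<^sub>R N) \<le> R"
    and "\<And>x y. (x, y) \<in> G \<Longrightarrow> x \<in> closure A \<and> y \<in> closure B \<and> c x y + c x0 y0 \<le> c x y0 + c x0 y"
    and "open O'" "x0 \<in> O'" and "l > 0"
  obtains x1 e S where "e > 0" "cball x1 e \<subseteq> O'" "S \<in> sets lebesgue" "G `` cball x1 e \<subseteq> S"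
    "emeasure lebesgue S < ennreal l * emeasure lebesgue (cball x1 e)"
proof (rule contact_image_in_slab[OF assms(1-13)])
  fix a x1 C assume a: "a \<noteq> 0" and slab: "\<And>t. t > 0 \<Longrightarrow> \<exists>e>0. cball x1 e \<subseteq> O' \<and>
      G `` cball x1 e \<subseteq> {y. norm (y - y0) \<le> C * e \<and> \<bar>a \<bullet> (y - y0)\<bar> \<le> t * e}"
  let ?b = "emeasure lebesgue (cball (0::'a) 1)"
  have "?b > 0"
    using content_cball_pos[of 1 "0::'a"] emeasure_eq_measure2[OF lmeasurable_cball, of "0::'a" 1]
    by (simp add: ennreal_less_zero_iff del: emeasure_completion)
  then have "ennreal l * ?b > 0"
    using \<open>l > 0\<close> by (simp add: ennreal_zero_less_mult_iff)
  then obtain t where t: "t > 0" "emeasure lebesgue {k. norm k \<le> C \<and> \<bar>a \<bullet> k\<bar> \<le> t} < ennreal l * ?b"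
    using thin_slab_emeasure[OF a] by blast
  let ?T = "{k. norm k \<le> C \<and> \<bar>a \<bullet> k\<bar> \<le> t}"
  obtain e where e: "e > 0" "cball x1 e \<subseteq> O'"
    "G `` cball x1 e \<subseteq> {y. norm (y - y0) \<le> C * e \<and> \<bar>a \<bullet> (y - y0)\<bar> \<le> t * e}"
    using slab[OF t(1)] by blast
  let ?S = "{y. norm (y - y0) \<le> C * e \<and> \<bar>a \<bullet> (y - y0)\<bar> \<le> t * e}"
  have "closed ?S"
    by (intro closed_Collect_conj closed_Collect_le continuous_intros)
  then have meas: "?S \<in> sets lebesgue"
    by (simp add: borel_closed sets_completionI_sets)
  have "?S = (\<lambda>k. e *\<^sub>R k + y0) ` ?T"
  proof safe
    fix y assume y: "norm (y - y0) \<le> C * e" "\<bar>a \<bullet> (y - y0)\<bar> \<le> t * e"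
    define k where "k = (1 / e) *\<^sub>R (y - y0)"
    have k: "y - y0 = e *\<^sub>R k"
      using e(1) by (simp add: k_def)
    have "k \<in> ?T"
      using y e(1) unfolding k by (simp add: abs_mult mult.commute[of _ e])
    moreover have "y = e *\<^sub>R k + y0"
      using k by (simp add: diff_eq_eq)
    ultimately show "y \<in> (\<lambda>k. e *\<^sub>R k + y0) ` ?T"
      by blast
  qed (use e(1) in \<open>auto simp: abs_mult mult.commute\<close>)
  then have "emeasure lebesgue ?S = ennreal (e ^ DIM('a)) * emeasure lebesgue ?T"
    using emeasure_lebesgue_affine[of e y0 ?T] e(1) by simp
  also have "\<dots> < ennreal (e ^ DIM('a)) * (ennreal l * ?b)"
    using t(2) e(1) by (intro ennreal_mult_strict_left_mono) auto
  also have "\<dots> = ennreal l * (ennreal (e ^ DIM('a)) * ?b)"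
    by (simp add: mult.left_commute)
  also have "ennreal (e ^ DIM('a)) * ?b = emeasure lebesgue (cball x1 e)"
  proof -
    have "(\<lambda>k. e *\<^sub>R k + x1) ` cball 0 1 = (\<lambda>x. x + x1) ` (\<lambda>k. e *\<^sub>R k) ` cball 0 1"
      by (simp add: image_image)
    also have "\<dots> = cball x1 e"
      using e(1) cball_scale[of e "0::'a" 1] image_add_cball[of x1 "0::'a" e] by (simp add: add.commute)
    finally have "cball x1 e = (\<lambda>k. e *\<^sub>R k + x1) ` cball 0 1" ..
    then show ?thesis
      using emeasure_lebesgue_affine[of e x1 "cball 0 1"] e(1) by simp
  qed
  finally show thesis
    using that[OF e(1,2) meas e(3)] by blast
qed

section \<open>The c-subdifferential\<close>

lemma B0_D:
  assumes "B0 U V c"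
  shows "open U" "open V" "compact (closure U)" "compact (closure V)"
    "continuous_on (closure U \<times> closure V) (\<lambda>(x, y). c x y)"
proof -
  show "open U" "open V" "compact (closure U)" "compact (closure V)"
    using assms by (auto simp: B0_def)
  obtain W where "closure U \<times> closure V \<subseteq> W" "Ck_on 4 W (\<lambda>(x, y). c x y)"
    using assms by (auto simp: B0_def Ck_near_def)
  then show "continuous_on (closure U \<times> closure V) (\<lambda>(x, y). c x y)"
    using Ck_on_mono[of 4 W "\<lambda>(x, y). c x y" 0] continuous_on_subset by auto
qed

text \<open>On the compact product \<open>c\<close> has a modulus of continuity in \<open>x\<close>
  uniform in \<open>y\<close>, and a finite supremum of functions sharing a modulus inherits
  it.\<close>

lemma c_convex_continuous:
  assumes B0: "B0 U V c" and u: "c_convex U V c u"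
  shows "continuous_on (closure U) u"
  unfolding continuous_on_iff
proof (intro ballI allI impI)
  fix x and e :: real assume x: "x \<in> closure U" and "e > 0"
  have "uniformly_continuous_on (closure U \<times> closure V) (\<lambda>(x, y). c x y)"
    using B0_D[OF B0] by (intro compact_uniformly_continuous compact_Times)
  then obtain d where d: "d > 0" "\<And>z z'. z \<in> closure U \<times> closure V \<Longrightarrow> z' \<in> closure U \<times> closure V \<Longrightarrow>
      dist z' z < d \<Longrightarrow> dist ((\<lambda>(x, y). c x y) z') ((\<lambda>(x, y). c x y) z) < e / 2"
    unfolding uniformly_continuous_on_def using \<open>e > 0\<close> half_gt_zero by metis
  have le: "u x1 \<le> u x2 + e / 2" if x12: "x1 \<in> closure U" "x2 \<in> closure U" "dist x1 x2 < d" for x1 x2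
  proof -
    let ?v = "cstar_transform U c (\<lambda>x. ereal (u x))"
    have "ereal (u x1) \<le> ereal (u x2 + e / 2)"
      unfolding u[unfolded c_convex_def, rule_format, OF x12(1)] c_transform_def
    proof (rule SUP_least)
      fix y assume y: "y \<in> closure V"
      have "- ereal (c x2 y) - ?v y \<le> ereal (u x2)"
        unfolding u[unfolded c_convex_def, rule_format, OF x12(2)] c_transform_def
        by (rule SUP_upper[OF y])
      moreover have "\<bar>c x1 y - c x2 y\<bar> < e / 2"
        using d(2)[of "(x2, y)" "(x1, y)"] x12 y by (simp add: dist_Pair_Pair dist_real_def)
      then have "- c x1 y \<le> - c x2 y + e / 2"
        by linarith
      ultimately show "- ereal (c x1 y) - ?v y \<le> ereal (u x2 + e / 2)"
        \<comment> \<open>The transform is not yet known to be finite, so infinite values are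
          treated too.\<close>
        by (cases "?v y") auto
    qed
    then show ?thesis
      by simp
  qed
  show "\<exists>d>0. \<forall>x'\<in>closure U. dist x' x < d \<longrightarrow> dist (u x') (u x) < e"
  proof (intro exI[of _ d] conjI ballI impI)
    fix x' assume x': "x' \<in> closure U" "dist x' x < d"
    then show "dist (u x') (u x) < e"
      using le[of x x'] le[of x' x] x \<open>e > 0\<close> by (auto simp: dist_real_def dist_commute)
  qed (rule d(1))
qed

text \<open>The supremum is minus the minimum of a continuous function on a compact set.
  Nonemptiness of \<open>U\<close> excludes the empty supremum, which is minus infinity.\<close>

lemma cstar_transform_attained:
  assumes B0: "B0 U V c" and u: "c_convex U V c u" and "U \<noteq> {}" and y: "y \<in> closure V"
  obtains x where "x \<in> closure U" "cstar_transform U c (\<lambda>x. ereal (u x)) y = ereal (- c x y - u x)"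
    "\<And>x'. x' \<in> closure U \<Longrightarrow> c x y + u x \<le> c x' y + u x'"
proof -
  have "continuous_on (closure U) (\<lambda>x. c x y)"
    using y by (intro continuous_on_compose2[OF B0_D(5)[OF B0], of _ "\<lambda>x. (x, y)", simplified])
      (auto intro!: continuous_intros)
  then have "continuous_on (closure U) (\<lambda>x. c x y + u x)"
    using c_convex_continuous[OF B0 u] by (intro continuous_intros)
  moreover have "closure U \<noteq> {}"
    using \<open>U \<noteq> {}\<close> by simp
  ultimately obtain x where x: "x \<in> closure U" "\<And>x'. x' \<in> closure U \<Longrightarrow> c x y + u x \<le> c x' y + u x'"
    using continuous_attains_inf[OF B0_D(3)[OF B0]] by blast
  have "cstar_transform U c (\<lambda>x. ereal (u x)) y = ereal (- c x y - u x)"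
    unfolding cstar_transform_def
  proof (rule antisym)
    show "(SUP x\<in>closure U. - ereal (c x y) - ereal (u x)) \<le> ereal (- c x y - u x)"
      using x(2) by (intro SUP_least) (auto simp: algebra_simps)
    show "ereal (- c x y - u x) \<le> (SUP x\<in>closure U. - ereal (c x y) - ereal (u x))"
      using x(1) by (intro SUP_upper2[of x]) auto
  qed
  then show ?thesis
    using that x by blast
qed

text \<open>Since the transform at \<open>y\<close> is minus a minimum, the defining equation says
  that \<open>x\<close> is a minimiser. This removes the extended reals from the rest of the
  argument.\<close>

lemma c_subdiff_iff:
  assumes B0: "B0 U V c" and u: "c_convex U V c u"
  shows "(x, y) \<in> c_subdiff U V c u \<longleftrightarrow> x \<in> closure U \<and> y \<in> closure V \<and>
    (\<forall>x'\<in>closure U. c x y + u x \<le> c x' y + u x')"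
proof (cases "x \<in> closure U \<and> y \<in> closure V")
  case True
  then have "U \<noteq> {}"
    by auto
  then obtain z where z: "z \<in> closure U" "cstar_transform U c (\<lambda>x. ereal (u x)) y = ereal (- c z y - u z)"
    "\<And>x'. x' \<in> closure U \<Longrightarrow> c z y + u z \<le> c x' y + u x'"
    using cstar_transform_attained[OF B0 u _ conjunct2[OF True]] by blast
  have "(x, y) \<in> c_subdiff U V c u \<longleftrightarrow> c x y + u x = c z y + u z"
    unfolding c_subdiff_def using True z(2) by (auto simp: zero_ereal_def)
  also have "\<dots> \<longleftrightarrow> (\<forall>x'\<in>closure U. c x y + u x \<le> c x' y + u x')"
    using True z(1,3) by (metis antisym)
  finally show ?thesis
    using True by simp
qed (auto simp: c_subdiff_def)

lemma c_subdiff_Image_closure: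
  assumes B0: "B0 U V c" and u: "c_convex U V c u" and "U \<noteq> {}"
  shows "c_subdiff U V c u `` closure U = closure V"
proof
  show "c_subdiff U V c u `` closure U \<subseteq> closure V"
    by (auto simp: c_subdiff_def)
  show "closure V \<subseteq> c_subdiff U V c u `` closure U"
  proof
    fix y assume y: "y \<in> closure V"
    obtain x where "x \<in> closure U" "\<And>x'. x' \<in> closure U \<Longrightarrow> c x y + u x \<le> c x' y + u x'"
      using cstar_transform_attained[OF B0 u \<open>U \<noteq> {}\<close> y] by blast
    then show "y \<in> c_subdiff U V c u `` closure U"
      using c_subdiff_iff[OF B0 u] y by (intro ImageI[of x]) auto
  qed
qed

text \<open>Two-point case of c-cyclical monotonicity: each point is tested as competitor in the
  minimality of the other, and \<open>u\<close> cancels in the sum.\<close>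

lemma c_subdiff_monotone:
  assumes "B0 U V c" "c_convex U V c u"
    and "(x, y) \<in> c_subdiff U V c u" "(x', y') \<in> c_subdiff U V c u"
  shows "c x y + c x' y' \<le> c x y' + c x' y"
proof -
  have "c x y + u x \<le> c x' y + u x'" "c x' y' + u x' \<le> c x y' + u x"
    using assms(3,4) unfolding c_subdiff_iff[OF assms(1,2)] by blast+
  then show ?thesis
    by linarith
qed

text \<open>One closed condition for each competitor, intersected inside a compact product. It
  supplies measurability in the case of the upper bound.\<close>

lemma compact_c_subdiff:
  assumes B0: "B0 U V c" and u: "c_convex U V c u"
  shows "compact (c_subdiff U V c u)"
proof -
  let ?K = "closure U \<times> closure V"
  have K: "compact ?K"
    using B0_D[OF B0] by (intro compact_Times)
  have "closed {z \<in> ?K. c (fst z) (snd z) + u (fst z) \<le> c x' (snd z) + u x'}" if "x' \<in> closure U" for x'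
  proof (rule continuous_on_closed_Collect_le)
    have cont: "continuous_on ?K (\<lambda>z. c (f z) (snd z))"
      if "continuous_on ?K f" "f ` ?K \<subseteq> closure U" for f
      using that by (intro continuous_on_compose2[OF B0_D(5)[OF B0], of _ "\<lambda>z. (f z, snd z)", simplified])
        (auto intro!: continuous_intros)
    show "continuous_on ?K (\<lambda>z. c x' (snd z) + u x')"
      using that by (intro continuous_intros cont) auto
    show "continuous_on ?K (\<lambda>z. c (fst z) (snd z) + u (fst z))"
      by (intro continuous_intros cont continuous_on_compose2[OF c_convex_continuous[OF B0 u]]) auto
  qed (use K compact_imp_closed in blast)
  then have "compact (?K \<inter> (\<Inter>x'\<in>closure U. {z \<in> ?K. c (fst z) (snd z) + u (fst z) \<le> c x' (snd z) + u x'}))"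
    by (intro compact_Int_closed[OF K]) auto
  also have "?K \<inter> (\<Inter>x'\<in>closure U. {z \<in> ?K. c (fst z) (snd z) + u (fst z) \<le> c x' (snd z) + u x'})
      = c_subdiff U V c u"
    by (auto simp: c_subdiff_iff[OF B0 u])
  finally show ?thesis .
qed

section \<open>Exclusion of contacts between interior and boundary\<close>

lemma c_subdiff_boundary_image:
  fixes U V :: "'a::euclidean_space set"
  assumes B0: "B0 U V c" and B1: "B1 U V c" and u: "c_convex U V c u" and "l > 0"
    and X: "X \<subseteq> closure U" "c_MA_ge_on U V c u l X" "strongly_cstar_convex_wrt c V X"
  shows "(X \<times> frontier V) \<inter> c_subdiff U V c u \<subseteq> frontier X \<times> frontier V"
proof (clarsimp)
  fix x y assume x: "x \<in> X" and y: "y \<in> frontier V" and xy: "(x, y) \<in> c_subdiff U V c u"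
  have xU: "x \<in> closure U" and yV: "y \<in> closure V"
    using xy by (auto simp: c_subdiff_def)
  show "x \<in> frontier X"
  proof (rule ccontr)
    assume "x \<notin> frontier X"
    then have int: "x \<in> interior X"
      using x closure_subset[of X] by (auto simp: frontier_def)
    have p: "diffeo_onto_range (closure V) (\<lambda>y. - Dx c x y)" and q: "diffeo_onto_range (closure U) (\<lambda>x. - Dy c x y)"
      using B1 xU yV by (auto simp: B1_def)
    obtain N R where NR: "norm N = 1" "R > 0"
      "\<And>y'. y' \<in> closure V \<Longrightarrow> norm (- Dx c x y' - - Dx c x y + R *\<^sub>R N) \<le> R"
      using X(3) x by (blast intro: strongly_convex_image_ball[OF p B0_D(2)[OF B0] y]
          dest: strongly_cstar_convex_wrt_def[THEN iffD1, rule_format])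
    obtain x1 e S where S: "e > 0" "cball x1 e \<subseteq> interior X" "S \<in> sets lebesgue"
      "c_subdiff U V c u `` cball x1 e \<subseteq> S"
      "emeasure lebesgue S < ennreal l * emeasure lebesgue (cball x1 e)"
    proof (rule contact_image_small[OF _ q p B0_D(2)[OF B0] B0_D(4)[OF B0] _ yV NR(1,2)])
      show "Ck_near 4 (closure U \<times> closure V) (\<lambda>(x, y). c x y)"
        using B0 by (simp add: B0_def)
      \<comment> \<open>\<open>X\<close> lies only in the closure of \<open>U\<close>, so its
        interior points are interior to that closure but possibly outside \<open>U\<close>.\<close>
      show "x \<in> interior (closure U)"
        using int interior_mono[OF X(1)] by blast
      show "norm (- Dx c x y' + Dx c x y + R *\<^sub>R N) \<le> R" if "y' \<in> closure V" for y'
        using NR(3)[OF that] by simp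
      show "x' \<in> closure U \<and> y' \<in> closure V \<and> c x' y' + c x y \<le> c x' y + c x y'"
        if "(x', y') \<in> c_subdiff U V c u" for x' y'
        using c_subdiff_monotone[OF B0 u that xy] that by (auto simp: c_subdiff_def)
    qed (use int \<open>l > 0\<close> in auto)
    have "cball x1 e \<subseteq> X"
      using S(2) interior_subset by blast
    then have "ennreal l * emeasure lebesgue (cball x1 e) \<le> emeasure lebesgue (c_subdiff U V c u `` cball x1 e)"
      using X(2) unfolding c_MA_ge_on_def c_MA_def by (metis borel_closed closed_cball)
    also have "\<dots> \<le> emeasure lebesgue S"
      by (rule emeasure_mono[OF S(4,3)])
    finally show False
      using S(5) by simp
  qed
qed

text \<open>The variables change roles, with the converse of the c-subdifferential as the relation.
  The preimage of a small ball in \<open>V\<close> has too little volume for its image, which covers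
  the ball, to respect the upper bound.\<close>

lemma c_subdiff_interior_image:
  fixes U V :: "'a::euclidean_space set"
  assumes B0: "B0 U V c" and B1: "B1 U V c" and u: "c_convex U V c u" and "L > 0"
    and MA: "c_MA_le_on U V c u L (closure U)" and conv: "strongly_c_convex_wrt c U V"
  shows "(frontier U \<times> V) \<inter> c_subdiff U V c u = {}"
proof (rule ccontr)
  assume "\<not> ?thesis"
  then obtain x y where x: "x \<in> frontier U" and y: "y \<in> V" and xy: "(x, y) \<in> c_subdiff U V c u"
    by blast
  have xU: "x \<in> closure U" and yV: "y \<in> closure V"
    using xy by (auto simp: c_subdiff_def)
  then have "U \<noteq> {}"
    by auto
  define c' where "c' = (\<lambda>y x. c x y)"
  have Dx': "Dx c' y x = Dy c x y" and Dy': "Dy c' y x = Dx c x y" for x y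
    by (simp_all add: c'_def Dx_def Dy_def)
  have q: "diffeo_onto_range (closure V) (\<lambda>y. - Dy c' y x)" and p: "diffeo_onto_range (closure U) (\<lambda>x. - Dx c' y x)"
    using B1 xU yV by (auto simp: B1_def Dx' Dy')
  have "strongly_convex ((\<lambda>x. - Dx c' y x) ` U)"
    using conv y by (simp add: strongly_c_convex_wrt_def Dx')
  then obtain N R where NR: "norm N = 1" "R > 0"
    "\<And>x'. x' \<in> closure U \<Longrightarrow> norm (- Dx c' y x' - - Dx c' y x + R *\<^sub>R N) \<le> R"
    by (rule strongly_convex_image_ball[OF p B0_D(1)[OF B0] x]) blast
  let ?G = "(c_subdiff U V c u)\<inverse>"
  obtain y1 e S where S: "e > 0" "cball y1 e \<subseteq> V" "S \<in> sets lebesgue" "?G `` cball y1 e \<subseteq> S"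
    "emeasure lebesgue S < ennreal (1 / L) * emeasure lebesgue (cball y1 e)"
  \<comment> \<open>The choice \<open>1 / L\<close> cancels the factor \<open>L\<close> of the upper
    bound at the end.\<close>
  proof (rule contact_image_small[where l = "1 / L", OF _ q p B0_D(1)[OF B0] B0_D(3)[OF B0] _ xU NR(1,2)])
    show "Ck_near 4 (closure V \<times> closure U) (\<lambda>(y, x). c' y x)"
      using Ck_near_swap[of 4 "closure U" "closure V" c] B0 by (simp add: B0_def c'_def)
    show "y \<in> interior (closure V)"
      using y B0_D(2)[OF B0] interior_maximal[OF closure_subset] by blast
    show "norm (- Dx c' y x' + Dx c' y x + R *\<^sub>R N) \<le> R" if "x' \<in> closure U" for x'
      using NR(3)[OF that] by simp
    show "y' \<in> closure V \<and> x' \<in> closure U \<and> c' y' x' + c' y x \<le> c' y' x + c' y x'"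
      if "(y', x') \<in> ?G" for x' y'
      using c_subdiff_monotone[OF B0 u _ xy, of x' y'] that by (auto simp: c_subdiff_def c'_def)
  qed (use y B0_D(2)[OF B0] \<open>L > 0\<close> in auto)
  let ?X = "?G `` cball y1 e"
  \<comment> \<open>As the projection of a compact set the preimage is compact, hence a Borel set to
    which the upper bound applies.\<close>
  have "?X = fst ` (c_subdiff U V c u \<inter> (UNIV \<times> cball y1 e))"
    by force
  moreover have "compact (c_subdiff U V c u \<inter> (UNIV \<times> cball y1 e))"
    by (intro compact_Int_closed[OF compact_c_subdiff[OF B0 u]] closed_Times) auto
  ultimately have "compact ?X"
    by (simp add: compact_continuous_image continuous_on_fst continuous_on_id)
  then have Xb: "?X \<in> sets borel"
    by (simp add: borel_closed compact_imp_closed)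
  have XU: "?X \<subseteq> closure U"
    by (auto simp: c_subdiff_def)
  have img: "cball y1 e \<subseteq> c_subdiff U V c u `` ?X"
  proof
    fix z assume z: "z \<in> cball y1 e"
    then have "z \<in> c_subdiff U V c u `` closure U"
      using S(2) closure_subset c_subdiff_Image_closure[OF B0 u \<open>U \<noteq> {}\<close>] by blast
    then show "z \<in> c_subdiff U V c u `` ?X"
      using z by blast
  qed
  \<comment> \<open>Here the larger set must be measurable, because \<open>emeasure\<close> vanishes
    on nonmeasurable sets and monotonicity could fail.\<close>
  have "compact (c_subdiff U V c u `` ?X)"
  proof -
    have "c_subdiff U V c u `` ?X = snd ` (c_subdiff U V c u \<inter> (?X \<times> UNIV))"
      by force
    moreover have "compact (c_subdiff U V c u \<inter> (?X \<times> UNIV))"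
      by (intro compact_Int_closed[OF compact_c_subdiff[OF B0 u]] closed_Times
          compact_imp_closed[OF \<open>compact ?X\<close>] closed_UNIV)
    ultimately show ?thesis
      by (simp add: compact_continuous_image continuous_on_snd continuous_on_id)
  qed
  then have "emeasure lebesgue (cball y1 e) \<le> c_MA U V c u ?X"
    unfolding c_MA_def by (intro emeasure_mono[OF img]) (simp add: lmeasurable_compact fmeasurableD)
  also have "\<dots> \<le> ennreal L * emeasure lebesgue ?X"
    using MA Xb XU unfolding c_MA_le_on_def by blast
  also have "\<dots> \<le> ennreal L * emeasure lebesgue S"
    by (intro mult_left_mono emeasure_mono[OF S(4,3)]) simp
  also have "\<dots> < ennreal L * (ennreal (1 / L) * emeasure lebesgue (cball y1 e))"
    using \<open>L > 0\<close> S(5) by (intro ennreal_mult_strict_left_mono) auto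
  also have "\<dots> = emeasure lebesgue (cball y1 e)"
    using \<open>L > 0\<close> by (simp add: mult.assoc[symmetric] ennreal_mult[symmetric])
  finally show False
    by simp
qed

theorem theorem5p1:
  fixes U V :: "(real ^ 'n) set"
    and c :: "real ^ 'n \<Rightarrow> real ^ 'n \<Rightarrow> real"
    and u :: "real ^ 'n \<Rightarrow> real"
    and l L :: real
  assumes "B0 U V c"
    and "B1 U V c"
    and "c_convex U V c u"
    and "l > 0"
    and "L > 0"
  shows "(U \<noteq> {} \<longrightarrow> c_subdiff U V c u `` closure U = closure V)
    \<and> (\<forall>X. X \<subseteq> closure U \<and> c_MA_ge_on U V c u l X \<and> strongly_cstar_convex_wrt c V X
          \<longrightarrow> (X \<times> frontier V) \<inter> c_subdiff U V c u \<subseteq> frontier X \<times> frontier V)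
    \<and> (c_MA_le_on U V c u L (closure U) \<and> strongly_c_convex_wrt c U V
          \<longrightarrow> (frontier U \<times> V) \<inter> c_subdiff U V c u = {})"
proof (intro conjI allI impI; (elim conjE)?)
  show "c_subdiff U V c u `` closure U = closure V" if "U \<noteq> {}"
    by (rule c_subdiff_Image_closure[OF assms(1,3) that])
  show "(X \<times> frontier V) \<inter> c_subdiff U V c u \<subseteq> frontier X \<times> frontier V"
    if "X \<subseteq> closure U" "c_MA_ge_on U V c u l X" "strongly_cstar_convex_wrt c V X" for X
    by (rule c_subdiff_boundary_image[OF assms(1-4) that])
  show "(frontier U \<times> V) \<inter> c_subdiff U V c u = {}"
    if "c_MA_le_on U V c u L (closure U)" "strongly_c_convex_wrt c U V"
    by (rule c_subdiff_interior_image[OF assms(1-3,5) that])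
qed

end
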